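(* Let $A=\bigoplus_{\sigma\in G}A_\sigma$ be a domain graded by an ordered-like semigroup $G$, and suppose that $A$ is faithfully flat as a left $A_0$-module (all rings being assumed to have the IBN property). Then any stably free non-free right ideal of $A_0$ can be lifted to $A$; that is, if $K$ is a right ideal of $A_0$ which is stably free but not free as a right $A_0$-module, then the induced right ideal $KA\cong K\otimes_{A_0}A$ of $A$ is stably free but not free as a right $A$-module.
   Context: All rings are unital, all modules are unital, and all rings are assumed to have the invariant basis number (IBN) property. Rings are not necessarily commutative. Semigroups $(G,+)$ are abelian, written additively, with neutral element $0$. A semigroup $(G,+)$ is called ordered-like if it has no invertible elements except $0$ and for any two finite subsets $S_1,S_2$ of $G$ (nonempty) such that $S=S_1+S_2\neq\{0\}$ there exists $c\in S$ with $$\nu(c)=|\{(a,b): a\in S_1,\ b\in S_2,\ a+b=c\}|=1.$$ A $G$-grading of $A$ is a decomposition $A=\bigoplus_{\sigma\in G}A_\sigma$ into additive (linear) subspaces with $A_\sigma A_\tau\subseteq A_{\sigma+\tau}$; $A_0$ is the component of degree $0$ and is a subalgebra. A finitely generated module $M$ over a ring $R$ is stably free if $M\oplus R^n\cong R^m$ for some nonnegative integers $n,m$. *)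

theory Defs
  imports "HOL-Algebra.Algebra"
begin

text \<open>
  All rings are unital and not necessarily commutative, so the library locales \<open>domain\<close> and
  \<open>module\<close>, which extend \<open>cring\<close>, do not apply.  Module structures are records extending
  \<open>ring\<close>, as in \<open>HOL-Algebra.Module\<close>; only the additive part and the scalar action of such a
  record are meaningful, so \<open>mult\<close> and \<open>one\<close> are filled in arbitrarily.
\<close>

locale noncomm_domain = ring R for R (structure) +
  assumes one_not_zero: "\<one> \<noteq> \<zero>"
    and integral: "\<lbrakk>a \<in> carrier R; b \<in> carrier R; a \<otimes> b = \<zero>\<rbrakk> \<Longrightarrow> a = \<zero> \<or> b = \<zero>"

locale right_ideal = additive_subgroup I R + ring R for I and R (structure) +
  assumes I_r_closed: "\<lbrakk>a \<in> I; x \<in> carrier R\<rbrakk> \<Longrightarrow> a \<otimes> x \<in> I"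


section \<open>One-sided modules\<close>

locale left_module = R?: ring R + M?: abelian_group M
  for R :: "('r, 'x) ring_scheme" (structure) and M :: "('r, 'm, 'y) module_scheme" (structure) +
  assumes smult_closed:
      "\<lbrakk>r \<in> carrier R; x \<in> carrier M\<rbrakk> \<Longrightarrow> r \<odot>\<^bsub>M\<^esub> x \<in> carrier M"
    and smult_l_distr:
      "\<lbrakk>r \<in> carrier R; s \<in> carrier R; x \<in> carrier M\<rbrakk> \<Longrightarrow>
        (r \<oplus>\<^bsub>R\<^esub> s) \<odot>\<^bsub>M\<^esub> x = r \<odot>\<^bsub>M\<^esub> x \<oplus>\<^bsub>M\<^esub> s \<odot>\<^bsub>M\<^esub> x"
    and smult_r_distr:
      "\<lbrakk>r \<in> carrier R; x \<in> carrier M; y \<in> carrier M\<rbrakk> \<Longrightarrow>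
        r \<odot>\<^bsub>M\<^esub> (x \<oplus>\<^bsub>M\<^esub> y) = r \<odot>\<^bsub>M\<^esub> x \<oplus>\<^bsub>M\<^esub> r \<odot>\<^bsub>M\<^esub> y"
    and smult_assoc:
      "\<lbrakk>r \<in> carrier R; s \<in> carrier R; x \<in> carrier M\<rbrakk> \<Longrightarrow>
        (r \<otimes>\<^bsub>R\<^esub> s) \<odot>\<^bsub>M\<^esub> x = r \<odot>\<^bsub>M\<^esub> (s \<odot>\<^bsub>M\<^esub> x)"
    and smult_one: "x \<in> carrier M \<Longrightarrow> \<one>\<^bsub>R\<^esub> \<odot>\<^bsub>M\<^esub> x = x"

record ('a, 'b) rmodule = "'b ring" +
  rsmult :: "['b, 'a] \<Rightarrow> 'b" (infixl \<open>\<star>\<index>\<close> 70)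

locale right_module = R?: ring R + M?: abelian_group M
  for R :: "('r, 'x) ring_scheme" (structure) and M :: "('r, 'm, 'y) rmodule_scheme" (structure) +
  assumes rsmult_closed:
      "\<lbrakk>x \<in> carrier M; r \<in> carrier R\<rbrakk> \<Longrightarrow> x \<star>\<^bsub>M\<^esub> r \<in> carrier M"
    and rsmult_r_distr:
      "\<lbrakk>x \<in> carrier M; r \<in> carrier R; s \<in> carrier R\<rbrakk> \<Longrightarrow>
        x \<star>\<^bsub>M\<^esub> (r \<oplus>\<^bsub>R\<^esub> s) = x \<star>\<^bsub>M\<^esub> r \<oplus>\<^bsub>M\<^esub> x \<star>\<^bsub>M\<^esub> s"
    and rsmult_l_distr:
      "\<lbrakk>x \<in> carrier M; y \<in> carrier M; r \<in> carrier R\<rbrakk> \<Longrightarrow>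
        (x \<oplus>\<^bsub>M\<^esub> y) \<star>\<^bsub>M\<^esub> r = x \<star>\<^bsub>M\<^esub> r \<oplus>\<^bsub>M\<^esub> y \<star>\<^bsub>M\<^esub> r"
    and rsmult_assoc:
      "\<lbrakk>x \<in> carrier M; r \<in> carrier R; s \<in> carrier R\<rbrakk> \<Longrightarrow>
        x \<star>\<^bsub>M\<^esub> (r \<otimes>\<^bsub>R\<^esub> s) = (x \<star>\<^bsub>M\<^esub> r) \<star>\<^bsub>M\<^esub> s"
    and rsmult_one: "x \<in> carrier M \<Longrightarrow> x \<star>\<^bsub>M\<^esub> \<one>\<^bsub>R\<^esub> = x"

definition rmod_hom ::
    "('r, 'x) ring_scheme \<Rightarrow> ('r, 'm, 'y) rmodule_scheme \<Rightarrow> ('r, 'n, 'z) rmodule_scheme \<Rightarrow> ('m \<Rightarrow> 'n) set"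
  where "rmod_hom R M N = {h \<in> carrier M \<rightarrow> carrier N.
    (\<forall>x\<in>carrier M. \<forall>y\<in>carrier M. h (x \<oplus>\<^bsub>M\<^esub> y) = h x \<oplus>\<^bsub>N\<^esub> h y) \<and>
    (\<forall>x\<in>carrier M. \<forall>r\<in>carrier R. h (x \<star>\<^bsub>M\<^esub> r) = h x \<star>\<^bsub>N\<^esub> r)}"

definition rmod_iso ::
    "('r, 'x) ring_scheme \<Rightarrow> ('r, 'm, 'y) rmodule_scheme \<Rightarrow> ('r, 'n, 'z) rmodule_scheme \<Rightarrow> ('m \<Rightarrow> 'n) set"
  where "rmod_iso R M N = {h \<in> rmod_hom R M N. bij_betw h (carrier M) (carrier N)}"

definition rmod_isomorphic ::
    "('r, 'x) ring_scheme \<Rightarrow> ('r, 'm, 'y) rmodule_scheme \<Rightarrow> ('r, 'n, 'z) rmodule_scheme \<Rightarrow> bool"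
  where "rmod_isomorphic R M N \<longleftrightarrow> rmod_iso R M N \<noteq> {}"

text \<open>A ring as a left module, over itself or (restricting the action) over any subring.\<close>

definition ring_lmodule :: "('a, 'x) ring_scheme \<Rightarrow> ('a, 'a) module"
  where "ring_lmodule R =
    \<lparr>carrier = carrier R, monoid.mult = (\<otimes>\<^bsub>R\<^esub>), one = \<one>\<^bsub>R\<^esub>, ring.zero = \<zero>\<^bsub>R\<^esub>, add = (\<oplus>\<^bsub>R\<^esub>),
     smult = (\<otimes>\<^bsub>R\<^esub>)\<rparr>"

text \<open>A right ideal \<open>I\<close> of \<open>R\<close> as a right \<open>R\<close>-module; \<open>I = carrier R\<close> is the regular module.\<close>

definition rideal_rmodule :: "('a, 'x) ring_scheme \<Rightarrow> 'a set \<Rightarrow> ('a, 'a) rmodule"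
  where "rideal_rmodule R I =
    \<lparr>carrier = I, monoid.mult = (\<otimes>\<^bsub>R\<^esub>), one = \<one>\<^bsub>R\<^esub>, ring.zero = \<zero>\<^bsub>R\<^esub>, add = (\<oplus>\<^bsub>R\<^esub>),
     rsmult = (\<otimes>\<^bsub>R\<^esub>)\<rparr>"

definition rpower :: "('a, 'x) ring_scheme \<Rightarrow> nat \<Rightarrow> ('a, nat \<Rightarrow> 'a) rmodule"
  where "rpower R n =
    \<lparr>carrier = {..<n} \<rightarrow>\<^sub>E carrier R, monoid.mult = undefined, one = undefined,
     ring.zero = (\<lambda>i\<in>{..<n}. \<zero>\<^bsub>R\<^esub>),
     add = (\<lambda>f g. \<lambda>i\<in>{..<n}. f i \<oplus>\<^bsub>R\<^esub> g i),
     rsmult = (\<lambda>f r. \<lambda>i\<in>{..<n}. f i \<otimes>\<^bsub>R\<^esub> r)\<rparr>"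

definition rmod_sum ::
    "('r, 'm, 'x) rmodule_scheme \<Rightarrow> ('r, 'n, 'y) rmodule_scheme \<Rightarrow> ('r, 'm \<times> 'n) rmodule"
  where "rmod_sum M N =
    \<lparr>carrier = carrier M \<times> carrier N, monoid.mult = undefined, one = undefined,
     ring.zero = (\<zero>\<^bsub>M\<^esub>, \<zero>\<^bsub>N\<^esub>),
     add = (\<lambda>(x, y) (x', y'). (x \<oplus>\<^bsub>M\<^esub> x', y \<oplus>\<^bsub>N\<^esub> y')),
     rsmult = (\<lambda>(x, y) r. (x \<star>\<^bsub>M\<^esub> r, y \<star>\<^bsub>N\<^esub> r))\<rparr>"


section \<open>Free and stably free modules, invariant basis number\<close>

text \<open>Finitely supported families \<open>(f i)\<^sub>i\<close> with \<open>f i \<in> F i\<close> for \<open>i \<in> I\<close>, extended by zero outside \<open>I\<close>.\<close>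

definition fin_families :: "('a, 'x) ring_scheme \<Rightarrow> 'i set \<Rightarrow> ('i \<Rightarrow> 'a set) \<Rightarrow> ('i \<Rightarrow> 'a) set"
  where "fin_families R I F =
    {f. (\<forall>i\<in>I. f i \<in> F i) \<and> (\<forall>i. i \<notin> I \<longrightarrow> f i = \<zero>\<^bsub>R\<^esub>) \<and> finite {i. f i \<noteq> \<zero>\<^bsub>R\<^esub>}}"

definition rlincomb :: "('r, 'x) ring_scheme \<Rightarrow> ('r, 'm, 'y) rmodule_scheme \<Rightarrow> ('m \<Rightarrow> 'r) \<Rightarrow> 'm"
  where "rlincomb R M c = (\<Oplus>\<^bsub>M\<^esub>b\<in>{b. c b \<noteq> \<zero>\<^bsub>R\<^esub>}. b \<star>\<^bsub>M\<^esub> c b)"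

definition rmod_basis :: "('r, 'x) ring_scheme \<Rightarrow> ('r, 'm, 'y) rmodule_scheme \<Rightarrow> 'm set \<Rightarrow> bool"
  where "rmod_basis R M B \<longleftrightarrow> B \<subseteq> carrier M \<and>
    (\<forall>x\<in>carrier M. \<exists>!c. c \<in> fin_families R B (\<lambda>_. carrier R) \<and> x = rlincomb R M c)"

definition rmod_free :: "('r, 'x) ring_scheme \<Rightarrow> ('r, 'm, 'y) rmodule_scheme \<Rightarrow> bool"
  where "rmod_free R M \<longleftrightarrow> right_module R M \<and> (\<exists>B. rmod_basis R M B)"

definition rmod_fin_gen :: "('r, 'x) ring_scheme \<Rightarrow> ('r, 'm, 'y) rmodule_scheme \<Rightarrow> bool"
  where "rmod_fin_gen R M \<longleftrightarrow> (\<exists>S. finite S \<and> S \<subseteq> carrier M \<and>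
    (\<forall>x\<in>carrier M. \<exists>c\<in>fin_families R S (\<lambda>_. carrier R). x = rlincomb R M c))"

definition stably_free :: "('r, 'x) ring_scheme \<Rightarrow> ('r, 'm, 'y) rmodule_scheme \<Rightarrow> bool"
  where "stably_free R M \<longleftrightarrow> right_module R M \<and> rmod_fin_gen R M \<and>
    (\<exists>n m. rmod_isomorphic R (rmod_sum M (rpower R n)) (rpower R m))"

text \<open>The property is left-right symmetric: isomorphisms \<open>R\<^sup>m \<cong> R\<^sup>n\<close> of left or of right modules
  both amount to mutually inverse rectangular matrices over \<open>R\<close>.\<close>

definition invariant_basis_number :: "('r, 'x) ring_scheme \<Rightarrow> bool"
  where "invariant_basis_number R \<longleftrightarrow>
    (\<forall>m n. rmod_isomorphic R (rpower R m) (rpower R n) \<longrightarrow> m = n)"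


section \<open>Tensor products and faithful flatness\<close>

text \<open>\<open>M \<otimes>\<^sub>R N\<close> for a right module \<open>M\<close> and a left module \<open>N\<close>: the free abelian group on the pairs
  modulo the balancing relations.\<close>

definition tensor_relators ::
    "('r, 'x) ring_scheme \<Rightarrow> ('r, 'm, 'y) rmodule_scheme \<Rightarrow> ('r, 'n, 'z) module_scheme \<Rightarrow> ('m \<times> 'n \<Rightarrow>\<^sub>0 int) set"
  where "tensor_relators R M N =
    {frag_of (x \<oplus>\<^bsub>M\<^esub> x', y) - frag_of (x, y) - frag_of (x', y) | x x' y.
       x \<in> carrier M \<and> x' \<in> carrier M \<and> y \<in> carrier N} \<union>
    {frag_of (x, y \<oplus>\<^bsub>N\<^esub> y') - frag_of (x, y) - frag_of (x, y') | x y y'.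
       x \<in> carrier M \<and> y \<in> carrier N \<and> y' \<in> carrier N} \<union>
    {frag_of (x \<star>\<^bsub>M\<^esub> r, y) - frag_of (x, r \<odot>\<^bsub>N\<^esub> y) | x r y.
       x \<in> carrier M \<and> r \<in> carrier R \<and> y \<in> carrier N}"

definition tensor_kernel ::
    "('r, 'x) ring_scheme \<Rightarrow> ('r, 'm, 'y) rmodule_scheme \<Rightarrow> ('r, 'n, 'z) module_scheme \<Rightarrow> ('m \<times> 'n \<Rightarrow>\<^sub>0 int) set"
  where "tensor_kernel R M N =
    generate (free_Abelian_group (carrier M \<times> carrier N)) (tensor_relators R M N)"

definition tensor_group ::
    "('r, 'x) ring_scheme \<Rightarrow> ('r, 'm, 'y) rmodule_scheme \<Rightarrow> ('r, 'n, 'z) module_scheme \<Rightarrow>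
     ('m \<times> 'n \<Rightarrow>\<^sub>0 int) set monoid"
  where "tensor_group R M N =
    free_Abelian_group (carrier M \<times> carrier N) Mod tensor_kernel R M N"

definition pure_tensor ::
    "('r, 'x) ring_scheme \<Rightarrow> ('r, 'm, 'y) rmodule_scheme \<Rightarrow> ('r, 'n, 'z) module_scheme \<Rightarrow>
     'm \<Rightarrow> 'n \<Rightarrow> ('m \<times> 'n \<Rightarrow>\<^sub>0 int) set"
  where "pure_tensor R M N x y =
    tensor_kernel R M N #>\<^bsub>free_Abelian_group (carrier M \<times> carrier N)\<^esub> frag_of (x, y)"

text \<open>The map \<open>f \<otimes> g\<close> into \<open>M' \<otimes>\<^sub>R N'\<close>.  The linear extension of \<open>(x, y) \<mapsto> (f x, g y)\<close> sends a coset of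
  the source relations into a single coset of the target relations; adding the target kernel to the
  image yields that coset.\<close>

definition tensor_map ::
    "('r, 'x) ring_scheme \<Rightarrow> ('r, 'm1, 'y) rmodule_scheme \<Rightarrow> ('r, 'n1, 'z) module_scheme \<Rightarrow>
     ('m \<Rightarrow> 'm1) \<Rightarrow> ('n \<Rightarrow> 'n1) \<Rightarrow> ('m \<times> 'n \<Rightarrow>\<^sub>0 int) set \<Rightarrow> ('m1 \<times> 'n1 \<Rightarrow>\<^sub>0 int) set"
  where "tensor_map R M' N' f g U =
    tensor_kernel R M' N' <#>\<^bsub>free_Abelian_group (carrier M' \<times> carrier N')\<^esub>
      (frag_extend (\<lambda>(x, y). frag_of (f x, g y)) ` U)"

text \<open>If \<open>N\<close> is a bimodule, with left action given by the record \<open>N\<close> and right action by the record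
  \<open>P\<close> (over the same additive group), then \<open>M \<otimes>\<^sub>R N\<close> is a right module via \<open>(x \<otimes> y)s = x \<otimes> (ys)\<close>.\<close>

definition tensor_rmodule ::
    "('r, 'x) ring_scheme \<Rightarrow> ('r, 'm, 'y) rmodule_scheme \<Rightarrow> ('r, 'n, 'z) module_scheme \<Rightarrow>
     ('s, 'n, 'w) rmodule_scheme \<Rightarrow> ('s, ('m \<times> 'n \<Rightarrow>\<^sub>0 int) set) rmodule"
  where "tensor_rmodule R M N P =
    \<lparr>carrier = carrier (tensor_group R M N), monoid.mult = undefined, one = undefined,
     ring.zero = \<one>\<^bsub>tensor_group R M N\<^esub>, add = (\<otimes>\<^bsub>tensor_group R M N\<^esub>),
     rsmult = (\<lambda>U s. tensor_map R M N (\<lambda>x. x) (\<lambda>y. y \<star>\<^bsub>P\<^esub> s) U)\<rparr>"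

text \<open>A left module \<open>N\<close> is faithfully flat if a sequence \<open>M1 \<rightarrow> M2 \<rightarrow> M3\<close> of right \<open>R\<close>-modules is exact
  precisely when the sequence tensored with \<open>N\<close> is exact.  HOL cannot quantify over types inside a
  definition, so the carrier type \<open>'u\<close> of the test modules is a parameter.  It is meant to be used
  with \<open>'u = (nat \<Rightarrow> 'r) set\<close>: every countably generated module is a quotient of \<open>R\<^sup>(\<^sup>\<nat>\<^sup>)\<close>, so has a copy
  on this type.  These test modules are enough to recover the property for all modules: flatness
  only needs the inclusions of right ideals into \<open>R\<close> that are finitely generated, and faithfulness
  only needs \<open>M \<otimes>\<^sub>R N \<noteq> 0\<close> for cyclic \<open>M \<noteq> 0\<close>.\<close>

definition faithfully_flat ::
    "'u itself \<Rightarrow> ('r, 'x) ring_scheme \<Rightarrow> ('r, 'n, 'z) module_scheme \<Rightarrow> bool"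
  where "faithfully_flat T R N \<longleftrightarrow> left_module R N \<and>
    (\<forall>(M1 :: ('r, 'u) rmodule) (M2 :: ('r, 'u) rmodule) (M3 :: ('r, 'u) rmodule) f g.
      right_module R M1 \<and> right_module R M2 \<and> right_module R M3 \<and>
      f \<in> rmod_hom R M1 M2 \<and> g \<in> rmod_hom R M2 M3 \<longrightarrow>
      (f ` carrier M1 = a_kernel M2 M3 g \<longleftrightarrow>
       tensor_map R M2 N f (\<lambda>y. y) ` carrier (tensor_group R M1 N) =
         kernel (tensor_group R M2 N) (tensor_group R M3 N) (tensor_map R M3 N g (\<lambda>y. y))))"


section \<open>Ordered-like semigroups and graded rings\<close>

text \<open>The semigroup \<open>(G, +)\<close> is an \<open>abelian_monoid\<close>: only \<open>carrier\<close>, \<open>\<oplus>\<close> and \<open>\<zero>\<close> of the ring record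
  are used.\<close>

definition ordered_like :: "('g, 'x) ring_scheme \<Rightarrow> bool"
  where "ordered_like G \<longleftrightarrow> abelian_monoid G \<and> Units (add_monoid G) = {\<zero>\<^bsub>G\<^esub>} \<and>
    (\<forall>S1 S2. S1 \<subseteq> carrier G \<and> S2 \<subseteq> carrier G \<and> finite S1 \<and> finite S2 \<and> S1 \<noteq> {} \<and> S2 \<noteq> {} \<and>
       S1 <+>\<^bsub>G\<^esub> S2 \<noteq> {\<zero>\<^bsub>G\<^esub>} \<longrightarrow>
       (\<exists>c\<in>S1 <+>\<^bsub>G\<^esub> S2. card {(a, b). a \<in> S1 \<and> b \<in> S2 \<and> a \<oplus>\<^bsub>G\<^esub> b = c} = 1))"

definition grading :: "('g, 'x) ring_scheme \<Rightarrow> ('a, 'y) ring_scheme \<Rightarrow> ('g \<Rightarrow> 'a set) \<Rightarrow> bool"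
  where "grading G A \<A> \<longleftrightarrow>
    (\<forall>\<sigma>\<in>carrier G. additive_subgroup (\<A> \<sigma>) A) \<and>
    (\<forall>a\<in>carrier A. \<exists>!f. f \<in> fin_families A (carrier G) \<A> \<and>
       a = (\<Oplus>\<^bsub>A\<^esub>\<sigma>\<in>{\<sigma>. f \<sigma> \<noteq> \<zero>\<^bsub>A\<^esub>}. f \<sigma>)) \<and>
    (\<forall>\<sigma>\<in>carrier G. \<forall>\<tau>\<in>carrier G. \<forall>a\<in>\<A> \<sigma>. \<forall>b\<in>\<A> \<tau>. a \<otimes>\<^bsub>A\<^esub> b \<in> \<A> (\<sigma> \<oplus>\<^bsub>G\<^esub> \<tau>))"

definition degree_zero_ring ::
    "('g, 'x) ring_scheme \<Rightarrow> ('a, 'y) ring_scheme \<Rightarrow> ('g \<Rightarrow> 'a set) \<Rightarrow> ('a, 'y) ring_scheme"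
  where "degree_zero_ring G A \<A> = A\<lparr>carrier := \<A> \<zero>\<^bsub>G\<^esub>\<rparr>"

end

theory Submission
  imports Defs
begin

text \<open>
  Write \<open>A\<^sub>0\<close> for the component of degree zero.  The ring \<open>A\<close> is related to \<open>A\<^sub>0\<close> in two ways, and each
  of them yields one half of the theorem.

  Extension of scalars from \<open>A\<^sub>0\<close> to \<open>A\<close> carries stable freeness upwards.  Flatness, applied to the
  inclusion \<open>K \<rightarrow> A\<^sub>0\<close>, makes the multiplication map \<open>K \<otimes> A \<rightarrow> A\<close> injective, so that it is an isomorphism
  onto \<open>KA\<close> (\<open>K_tensor_A_iso_KA\<close>).  Through it \<open>KA\<close> inherits the universal property of the
  tensor product: an \<open>A\<^sub>0\<close>-linear map from \<open>K\<close> into a right \<open>A\<close>-module extends to an \<open>A\<close>-linear map on \<open>KA\<close>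
  (\<open>extend_hom_KA\<close>), in exactly one way because \<open>K\<close> generates \<open>KA\<close>.  The inclusions
  \<open>A\<^sub>0\<^sup>n \<subseteq> A\<^sup>n\<close> have the same property.  Hence an isomorphism \<open>K \<oplus> A\<^sub>0\<^sup>n \<cong> A\<^sub>0\<^sup>m\<close> and its inverse both extend, and the
  extensions are inverse to each other by uniqueness (\<open>stably_free_KA\<close>).

  Conversely, freeness passes downwards along a retraction \<open>A \<rightarrow> A\<^sub>0\<close>.  Zero is the only invertible
  element of the grading semigroup, so a sum of two degrees vanishes only if both degrees do.
  Therefore the elements without component of degree zero form a two-sided ideal \<open>J\<close>, the augmentation
  ideal (\<open>ideal_augmentation\<close>), and \<open>A = A\<^sub>0 \<oplus> J\<close>; the projection \<open>p\<close> onto \<open>A\<^sub>0\<close> is a ring homomorphism that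
  fixes \<open>A\<^sub>0\<close>.  It maps \<open>KA\<close> onto \<open>K\<close>, and the kernel of this map is \<open>KA \<inter> J = (KA)J\<close>: if
  \<open>x = \<Sum> k\<^sub>i a\<^sub>i\<close> lies in \<open>J\<close>, then \<open>x = x - p(x) = \<Sum> k\<^sub>i (a\<^sub>i - p(a\<^sub>i))\<close>.  So \<open>K \<cong> KA/(KA)J\<close>, and the image
  of an \<open>A\<close>-basis of \<open>KA\<close> under \<open>p\<close> is an \<open>A\<^sub>0\<close>-basis of \<open>K\<close> (\<open>free_descends\<close>).  If \<open>KA\<close> were free, \<open>K\<close> would be
  free as well.
\<close>

section \<open>Linear combinations and bases in right modules\<close>

context right_module
begin

lemma zero_rsmult [simp]:
  assumes "r \<in> carrier R" shows "\<zero>\<^bsub>M\<^esub> \<star>\<^bsub>M\<^esub> r = \<zero>\<^bsub>M\<^esub>"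
proof -
  have "\<zero>\<^bsub>M\<^esub> \<star>\<^bsub>M\<^esub> r \<oplus>\<^bsub>M\<^esub> \<zero>\<^bsub>M\<^esub> \<star>\<^bsub>M\<^esub> r = \<zero>\<^bsub>M\<^esub> \<star>\<^bsub>M\<^esub> r"
    using assms by (simp flip: rsmult_l_distr)
  then show ?thesis
    using assms by (simp add: M.add.r_cancel_one rsmult_closed)
qed

lemma rsmult_zero [simp]:
  assumes "x \<in> carrier M" shows "x \<star>\<^bsub>M\<^esub> \<zero>\<^bsub>R\<^esub> = \<zero>\<^bsub>M\<^esub>"
proof -
  have "x \<star>\<^bsub>M\<^esub> \<zero>\<^bsub>R\<^esub> \<oplus>\<^bsub>M\<^esub> x \<star>\<^bsub>M\<^esub> \<zero>\<^bsub>R\<^esub> = x \<star>\<^bsub>M\<^esub> \<zero>\<^bsub>R\<^esub>"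
    using assms by (simp flip: rsmult_r_distr)
  then show ?thesis
    using assms by (simp add: M.add.r_cancel_one rsmult_closed)
qed

lemma finsum_rsmult:
  assumes "r \<in> carrier R" "f \<in> I \<rightarrow> carrier M"
  shows "(\<Oplus>\<^bsub>M\<^esub>i\<in>I. f i) \<star>\<^bsub>M\<^esub> r = (\<Oplus>\<^bsub>M\<^esub>i\<in>I. f i \<star>\<^bsub>M\<^esub> r)"
  using assms(2)
proof (induction I rule: infinite_finite_induct)
  case (insert i I)
  then show ?case
    using assms(1) by (simp add: Pi_iff M.finsum_insert rsmult_l_distr rsmult_closed)
qed (use assms(1) in \<open>simp_all add: M.finsum_infinite\<close>)

lemma rlincomb_eq_finsum:
  assumes "finite T" "{b. c b \<noteq> \<zero>\<^bsub>R\<^esub>} \<subseteq> T" "T \<subseteq> carrier M" "\<And>b. b \<in> T \<Longrightarrow> c b \<in> carrier R"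
  shows "rlincomb R M c = (\<Oplus>\<^bsub>M\<^esub>b\<in>T. b \<star>\<^bsub>M\<^esub> c b)"
  unfolding rlincomb_def
  using assms by (intro M.add.finprod_mono_neutral_cong_left) (auto simp: subset_iff rsmult_closed)

lemma finsum_diff_coeffs:
  assumes "finite T" "T \<subseteq> carrier M" "\<And>b. b \<in> T \<Longrightarrow> c b \<in> carrier R" "\<And>b. b \<in> T \<Longrightarrow> d b \<in> carrier R"
  shows "(\<Oplus>\<^bsub>M\<^esub>b\<in>T. b \<star>\<^bsub>M\<^esub> c b) \<ominus>\<^bsub>M\<^esub> (\<Oplus>\<^bsub>M\<^esub>b\<in>T. b \<star>\<^bsub>M\<^esub> d b) = (\<Oplus>\<^bsub>M\<^esub>b\<in>T. b \<star>\<^bsub>M\<^esub> (c b \<ominus>\<^bsub>R\<^esub> d b))"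
proof -
  have 1: "(\<Oplus>\<^bsub>M\<^esub>b\<in>T. b \<star>\<^bsub>M\<^esub> d b) \<in> carrier M" "(\<Oplus>\<^bsub>M\<^esub>b\<in>T. b \<star>\<^bsub>M\<^esub> (c b \<ominus>\<^bsub>R\<^esub> d b)) \<in> carrier M"
    "(\<Oplus>\<^bsub>M\<^esub>b\<in>T. b \<star>\<^bsub>M\<^esub> c b) \<in> carrier M"
    using assms by (auto intro!: M.finsum_closed rsmult_closed)
  have "(\<Oplus>\<^bsub>M\<^esub>b\<in>T. b \<star>\<^bsub>M\<^esub> (c b \<ominus>\<^bsub>R\<^esub> d b)) \<oplus>\<^bsub>M\<^esub> (\<Oplus>\<^bsub>M\<^esub>b\<in>T. b \<star>\<^bsub>M\<^esub> d b)
     = (\<Oplus>\<^bsub>M\<^esub>b\<in>T. b \<star>\<^bsub>M\<^esub> (c b \<ominus>\<^bsub>R\<^esub> d b) \<oplus>\<^bsub>M\<^esub> b \<star>\<^bsub>M\<^esub> d b)"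
    using assms by (subst M.finsum_addf) (auto intro!: rsmult_closed)
  also have "\<dots> = (\<Oplus>\<^bsub>M\<^esub>b\<in>T. b \<star>\<^bsub>M\<^esub> c b)"
  proof (rule M.finsum_cong')
    fix b assume "b \<in> T"
    then have "b \<in> carrier M" "c b \<in> carrier R" "d b \<in> carrier R"
      using assms by auto
    then show "b \<star>\<^bsub>M\<^esub> (c b \<ominus>\<^bsub>R\<^esub> d b) \<oplus>\<^bsub>M\<^esub> b \<star>\<^bsub>M\<^esub> d b = b \<star>\<^bsub>M\<^esub> c b"
      by (simp flip: rsmult_r_distr add: a_minus_def R.a_assoc R.l_neg)
  qed (use assms in \<open>auto intro!: rsmult_closed\<close>)
  finally have "(\<Oplus>\<^bsub>M\<^esub>b\<in>T. b \<star>\<^bsub>M\<^esub> c b)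
      = (\<Oplus>\<^bsub>M\<^esub>b\<in>T. b \<star>\<^bsub>M\<^esub> (c b \<ominus>\<^bsub>R\<^esub> d b)) \<oplus>\<^bsub>M\<^esub> (\<Oplus>\<^bsub>M\<^esub>b\<in>T. b \<star>\<^bsub>M\<^esub> d b)" ..
  then show ?thesis
    using 1 by (simp only: a_minus_def[of M] M.a_assoc M.a_inv_closed M.r_neg M.r_zero)
qed

text \<open>Coefficient functions on the whole module type, vanishing off a finite set, become coefficients
  on an explicit finite subset of \<open>B\<close>, and uniqueness becomes linear independence.  In this form bases
  can be moved along maps, since finite sums can be reindexed.\<close>

lemma rmod_basis_iff:
  "rmod_basis R M B \<longleftrightarrow> B \<subseteq> carrier M \<and>
    (\<forall>x\<in>carrier M. \<exists>T c. finite T \<and> T \<subseteq> B \<and> (\<forall>b\<in>T. c b \<in> carrier R) \<and> x = (\<Oplus>\<^bsub>M\<^esub>b\<in>T. b \<star>\<^bsub>M\<^esub> c b)) \<and>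
    (\<forall>T c. finite T \<and> T \<subseteq> B \<and> (\<forall>b\<in>T. c b \<in> carrier R) \<and> (\<Oplus>\<^bsub>M\<^esub>b\<in>T. b \<star>\<^bsub>M\<^esub> c b) = \<zero>\<^bsub>M\<^esub>
      \<longrightarrow> (\<forall>b\<in>T. c b = \<zero>\<^bsub>R\<^esub>))" (is "?L \<longleftrightarrow> ?B \<and> ?S \<and> ?I")
proof
  assume L: ?L
  then have B: ?B by (simp add: rmod_basis_def)
  have ex1: "\<exists>!c. c \<in> fin_families R B (\<lambda>_. carrier R) \<and> x = rlincomb R M c" if "x \<in> carrier M" for x
    using L that by (simp add: rmod_basis_def)
  have ?S
  proof
    fix x assume "x \<in> carrier M"
    then obtain c where c: "c \<in> fin_families R B (\<lambda>_. carrier R)" "x = rlincomb R M c"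
      using ex1 by blast
    then have "{b. c b \<noteq> \<zero>\<^bsub>R\<^esub>} \<subseteq> B" "finite {b. c b \<noteq> \<zero>\<^bsub>R\<^esub>}" "\<forall>b\<in>B. c b \<in> carrier R"
      by (auto simp: fin_families_def)
    then show "\<exists>T c. finite T \<and> T \<subseteq> B \<and> (\<forall>b\<in>T. c b \<in> carrier R) \<and> x = (\<Oplus>\<^bsub>M\<^esub>b\<in>T. b \<star>\<^bsub>M\<^esub> c b)"
      using c(2) unfolding rlincomb_def by blast
  qed
  moreover have ?I
  proof (intro allI impI)
    fix T c
    assume T: "finite T \<and> T \<subseteq> B \<and> (\<forall>b\<in>T. c b \<in> carrier R) \<and> (\<Oplus>\<^bsub>M\<^esub>b\<in>T. b \<star>\<^bsub>M\<^esub> c b) = \<zero>\<^bsub>M\<^esub>"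
    define c' where "c' = (\<lambda>b. if b \<in> T then c b else \<zero>\<^bsub>R\<^esub>)"
    have f: "c' \<in> fin_families R B (\<lambda>_. carrier R)" "(\<lambda>_. \<zero>\<^bsub>R\<^esub>) \<in> fin_families R B (\<lambda>_. carrier R)"
      using T by (auto simp: fin_families_def c'_def elim: rev_finite_subset)
    have "rlincomb R M c' = (\<Oplus>\<^bsub>M\<^esub>b\<in>T. b \<star>\<^bsub>M\<^esub> c' b)"
      using T B by (intro rlincomb_eq_finsum) (auto simp: c'_def split: if_splits)
    also have "\<dots> = (\<Oplus>\<^bsub>M\<^esub>b\<in>T. b \<star>\<^bsub>M\<^esub> c b)"
      using T B by (intro M.finsum_cong') (auto simp: c'_def intro!: rsmult_closed)
    finally have "rlincomb R M c' = \<zero>\<^bsub>M\<^esub>" using T by simp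
    moreover have "rlincomb R M (\<lambda>_. \<zero>\<^bsub>R\<^esub>) = \<zero>\<^bsub>M\<^esub>"
      by (simp add: rlincomb_def)
    ultimately have "c' = (\<lambda>_. \<zero>\<^bsub>R\<^esub>)"
      using ex1[OF M.zero_closed] f by metis
    then show "\<forall>b\<in>T. c b = \<zero>\<^bsub>R\<^esub>"
      by (metis c'_def)
  qed
  ultimately show "?B \<and> ?S \<and> ?I" using B by blast
next
  assume "?B \<and> ?S \<and> ?I"
  then have R: ?B and span: ?S and indep: ?I by (rule conjunct1, simp_all)
  show ?L
    unfolding rmod_basis_def
  proof (intro conjI ballI ex_ex1I)
    show ?B by (rule R)
    fix x assume "x \<in> carrier M"
    then obtain T c where T: "finite T" "T \<subseteq> B" "\<forall>b\<in>T. c b \<in> carrier R" "x = (\<Oplus>\<^bsub>M\<^esub>b\<in>T. b \<star>\<^bsub>M\<^esub> c b)"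
      using bspec[OF span] by blast
    define c' where "c' = (\<lambda>b. if b \<in> T then c b else \<zero>\<^bsub>R\<^esub>)"
    have "rlincomb R M c' = (\<Oplus>\<^bsub>M\<^esub>b\<in>T. b \<star>\<^bsub>M\<^esub> c' b)"
      using T R by (intro rlincomb_eq_finsum) (auto simp: c'_def split: if_splits)
    also have "\<dots> = (\<Oplus>\<^bsub>M\<^esub>b\<in>T. b \<star>\<^bsub>M\<^esub> c b)"
      using T R by (intro M.finsum_cong') (auto simp: c'_def intro!: rsmult_closed)
    moreover have "c' \<in> fin_families R B (\<lambda>_. carrier R)"
      using T by (auto simp: fin_families_def c'_def elim: rev_finite_subset)
    ultimately show "\<exists>c. c \<in> fin_families R B (\<lambda>_. carrier R) \<and> x = rlincomb R M c"
      using T by metis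
  next
    fix x c d
    assume c: "c \<in> fin_families R B (\<lambda>_. carrier R) \<and> x = rlincomb R M c"
      and d: "d \<in> fin_families R B (\<lambda>_. carrier R) \<and> x = rlincomb R M d"
    define T where "T = {b. c b \<noteq> \<zero>\<^bsub>R\<^esub>} \<union> {b. d b \<noteq> \<zero>\<^bsub>R\<^esub>}"
    have T: "finite T" "T \<subseteq> B" "\<And>b. b \<in> T \<Longrightarrow> c b \<in> carrier R" "\<And>b. b \<in> T \<Longrightarrow> d b \<in> carrier R"
      using c d by (auto simp: T_def fin_families_def)
    have TM: "T \<subseteq> carrier M" using T R by blast
    have "rlincomb R M c = (\<Oplus>\<^bsub>M\<^esub>b\<in>T. b \<star>\<^bsub>M\<^esub> c b)" "rlincomb R M d = (\<Oplus>\<^bsub>M\<^esub>b\<in>T. b \<star>\<^bsub>M\<^esub> d b)"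
      using T TM by (intro rlincomb_eq_finsum; auto simp: T_def)+
    then have eq: "(\<Oplus>\<^bsub>M\<^esub>b\<in>T. b \<star>\<^bsub>M\<^esub> c b) = (\<Oplus>\<^bsub>M\<^esub>b\<in>T. b \<star>\<^bsub>M\<^esub> d b)"
      using c d by simp
    have "(\<Oplus>\<^bsub>M\<^esub>b\<in>T. b \<star>\<^bsub>M\<^esub> d b) \<in> carrier M"
      using T TM by (auto intro!: M.finsum_closed rsmult_closed)
    then have "(\<Oplus>\<^bsub>M\<^esub>b\<in>T. b \<star>\<^bsub>M\<^esub> (c b \<ominus>\<^bsub>R\<^esub> d b)) = \<zero>\<^bsub>M\<^esub>"
      using finsum_diff_coeffs[of T c d] T TM eq by (simp add: M.r_neg a_minus_def)
    then have *: "finite T \<and> T \<subseteq> B \<and> (\<forall>b\<in>T. c b \<ominus>\<^bsub>R\<^esub> d b \<in> carrier R) \<and>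
        (\<Oplus>\<^bsub>M\<^esub>b\<in>T. b \<star>\<^bsub>M\<^esub> (c b \<ominus>\<^bsub>R\<^esub> d b)) = \<zero>\<^bsub>M\<^esub>"
      using T by blast
    have "c b = d b" if "b \<in> T" for b
      using indep[rule_format, OF * that] T that R.r_right_minus_eq by metis
    moreover have "c b = d b" if "b \<notin> T" for b
      using that by (simp add: T_def)
    ultimately show "c = d" by blast
  qed
qed

lemma finsum_coeffs_extend:
  assumes "finite S" "T \<subseteq> S" "S \<subseteq> carrier M" "\<And>b. b \<in> T \<Longrightarrow> c b \<in> carrier R"
  shows "(\<Oplus>\<^bsub>M\<^esub>b\<in>T. b \<star>\<^bsub>M\<^esub> c b) = (\<Oplus>\<^bsub>M\<^esub>b\<in>S. b \<star>\<^bsub>M\<^esub> (if b \<in> T then c b else \<zero>\<^bsub>R\<^esub>))"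
  using assms by (intro M.add.finprod_mono_neutral_cong_left) (auto simp: subset_iff rsmult_closed)

lemma basis_coeffs_unique:
  assumes B: "rmod_basis R M B"
    and T: "finite T" "T \<subseteq> B" "\<And>b. b \<in> T \<Longrightarrow> c b \<in> carrier R"
    and S: "finite S" "S \<subseteq> B" "\<And>b. b \<in> S \<Longrightarrow> d b \<in> carrier R"
    and eq: "(\<Oplus>\<^bsub>M\<^esub>b\<in>T. b \<star>\<^bsub>M\<^esub> c b) = (\<Oplus>\<^bsub>M\<^esub>b\<in>S. b \<star>\<^bsub>M\<^esub> d b)" and b: "b \<in> T"
  shows "c b = (if b \<in> S then d b else \<zero>\<^bsub>R\<^esub>)"
proof -
  define U where "U = T \<union> S"
  define c' where "c' = (\<lambda>b. if b \<in> T then c b else \<zero>\<^bsub>R\<^esub>)"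
  define d' where "d' = (\<lambda>b. if b \<in> S then d b else \<zero>\<^bsub>R\<^esub>)"
  have U: "finite U" "U \<subseteq> B" "U \<subseteq> carrier M" "T \<subseteq> U" "S \<subseteq> U"
    using B T S by (auto simp: rmod_basis_def U_def)
  have cd: "\<And>b. c' b \<in> carrier R" "\<And>b. d' b \<in> carrier R"
    using T S by (auto simp: c'_def d'_def)
  have 1: "(\<Oplus>\<^bsub>M\<^esub>b\<in>U. b \<star>\<^bsub>M\<^esub> c' b) = (\<Oplus>\<^bsub>M\<^esub>b\<in>U. b \<star>\<^bsub>M\<^esub> d' b)"
    using eq finsum_coeffs_extend[of U T c] finsum_coeffs_extend[of U S d] U T S
    unfolding c'_def d'_def by simp
  have "(\<Oplus>\<^bsub>M\<^esub>b\<in>U. b \<star>\<^bsub>M\<^esub> d' b) \<in> carrier M"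
    by (rule M.finsum_closed) (use U cd in \<open>fastforce intro!: rsmult_closed\<close>)
  then have "(\<Oplus>\<^bsub>M\<^esub>b\<in>U. b \<star>\<^bsub>M\<^esub> (c' b \<ominus>\<^bsub>R\<^esub> d' b)) = \<zero>\<^bsub>M\<^esub>"
    using finsum_diff_coeffs[OF U(1,3), of c' d'] cd 1 by (simp add: a_minus_def M.r_neg)
  then have "c' b \<ominus>\<^bsub>R\<^esub> d' b = \<zero>\<^bsub>R\<^esub>"
    using U b cd
      B[unfolded rmod_basis_iff, THEN conjunct2, THEN conjunct2, rule_format, of U "\<lambda>b. c' b \<ominus>\<^bsub>R\<^esub> d' b" b]
    by auto
  then have "c' b = d' b"
    using cd by (meson R.r_right_minus_eq)
  then show ?thesis using b by (simp add: c'_def d'_def)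
qed

end

text \<open>Passing to a submodule or to a subring changes the record in which a sum is formed; this lemma
  moves all such sums into the ambient ring.\<close>

lemma finsum_subrecord:
  assumes "abelian_monoid M" "abelian_monoid N" "carrier M \<subseteq> carrier N" "add M = add N"
    "\<zero>\<^bsub>M\<^esub> = \<zero>\<^bsub>N\<^esub>" "f \<in> I \<rightarrow> carrier M"
  shows "finsum M f I = finsum N f I"
proof -
  interpret M: abelian_monoid M by fact
  interpret N: abelian_monoid N by fact
  show ?thesis
    using assms(6)
  proof (induction I rule: infinite_finite_induct)
    case (insert i I)
    then have "f i \<in> carrier N" "f \<in> I \<rightarrow> carrier N"
      using assms(3) by (auto simp: Pi_iff)
    with insert show ?case
      using assms by (simp add: Pi_iff)
  qed (simp_all add: assms)
qed

lemma rideal_rmodule_simps [simp]: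
  "carrier (rideal_rmodule R I) = I" "add (rideal_rmodule R I) = add R"
  "\<zero>\<^bsub>rideal_rmodule R I\<^esub> = \<zero>\<^bsub>R\<^esub>" "rsmult (rideal_rmodule R I) = monoid.mult R"
  by (simp_all add: rideal_rmodule_def)

lemma (in right_ideal) right_module_rideal: "right_module R (rideal_rmodule R I)"
proof -
  have "abelian_group (rideal_rmodule R I)"
  proof (rule abelian_groupI)
    fix x assume "x \<in> carrier (rideal_rmodule R I)"
    then show "\<exists>y\<in>carrier (rideal_rmodule R I). y \<oplus>\<^bsub>rideal_rmodule R I\<^esub> x = \<zero>\<^bsub>rideal_rmodule R I\<^esub>"
      using a_inv_closed by (auto intro!: bexI[of _ "\<ominus> x"] simp: l_neg)
  qed (auto simp: a_ac)
  then show ?thesis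
    by (intro right_module.intro right_module_axioms.intro ring_axioms)
      (auto simp: I_r_closed r_distr l_distr m_assoc)
qed

lemma (in ring) right_ideal_carrier: "right_ideal (carrier R) R"
  by (intro right_ideal.intro right_ideal_axioms.intro ring_axioms)
    (simp_all add: additive_subgroup.intro add.subgroup_self)

lemma (in right_ideal) finsum_rideal:
  "f \<in> S \<rightarrow> I \<Longrightarrow> finsum (rideal_rmodule R I) f S = finsum R f S"
proof (rule finsum_subrecord)
  interpret right_module R "rideal_rmodule R I" by (rule right_module_rideal)
  show "abelian_monoid (rideal_rmodule R I)" by unfold_locales
qed (simp_all add: abelian_monoid_axioms subset_iff)

context right_module
begin

lemma rmod_fin_gen_iff:
  "rmod_fin_gen R M \<longleftrightarrow> (\<exists>S. finite S \<and> S \<subseteq> carrier M \<and>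
    (\<forall>x\<in>carrier M. \<exists>c. (\<forall>b\<in>S. c b \<in> carrier R) \<and> x = (\<Oplus>\<^bsub>M\<^esub>b\<in>S. b \<star>\<^bsub>M\<^esub> c b)))"
proof -
  have "(\<exists>c\<in>fin_families R S (\<lambda>_. carrier R). x = rlincomb R M c) \<longleftrightarrow>
      (\<exists>c. (\<forall>b\<in>S. c b \<in> carrier R) \<and> x = (\<Oplus>\<^bsub>M\<^esub>b\<in>S. b \<star>\<^bsub>M\<^esub> c b))"
    if S: "finite S" "S \<subseteq> carrier M" for S x
  proof
    assume "\<exists>c\<in>fin_families R S (\<lambda>_. carrier R). x = rlincomb R M c"
    then obtain c where c: "c \<in> fin_families R S (\<lambda>_. carrier R)" "x = rlincomb R M c" by blast
    then have "x = (\<Oplus>\<^bsub>M\<^esub>b\<in>S. b \<star>\<^bsub>M\<^esub> c b)"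
      using rlincomb_eq_finsum[of S c] S by (auto simp: fin_families_def)
    then show "\<exists>c. (\<forall>b\<in>S. c b \<in> carrier R) \<and> x = (\<Oplus>\<^bsub>M\<^esub>b\<in>S. b \<star>\<^bsub>M\<^esub> c b)"
      using c(1) by (auto simp: fin_families_def)
  next
    assume "\<exists>c. (\<forall>b\<in>S. c b \<in> carrier R) \<and> x = (\<Oplus>\<^bsub>M\<^esub>b\<in>S. b \<star>\<^bsub>M\<^esub> c b)"
    then obtain c where c: "\<forall>b\<in>S. c b \<in> carrier R" "x = (\<Oplus>\<^bsub>M\<^esub>b\<in>S. b \<star>\<^bsub>M\<^esub> c b)" by blast
    define c' where "c' = (\<lambda>b. if b \<in> S then c b else \<zero>\<^bsub>R\<^esub>)"
    have sub: "{b. c' b \<noteq> \<zero>\<^bsub>R\<^esub>} \<subseteq> S" by (auto simp: c'_def)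
    have "rlincomb R M c' = (\<Oplus>\<^bsub>M\<^esub>b\<in>S. b \<star>\<^bsub>M\<^esub> c' b)"
      using S sub c(1) by (intro rlincomb_eq_finsum) (auto simp: c'_def)
    also have "\<dots> = x"
      unfolding c(2) using S c(1) by (intro M.finsum_cong') (auto simp: c'_def intro!: rsmult_closed)
    finally have "x = rlincomb R M c'" ..
    moreover have "c' \<in> fin_families R S (\<lambda>_. carrier R)"
      using c(1) finite_subset[OF sub S(1)] by (auto simp: fin_families_def c'_def)
    ultimately show "\<exists>c\<in>fin_families R S (\<lambda>_. carrier R). x = rlincomb R M c" by blast
  qed
  then show ?thesis
    unfolding rmod_fin_gen_def by (intro arg_cong[of _ _ Ex] ext conj_cong ball_cong refl)
qed

end


section \<open>Homomorphisms, free modules of finite rank and direct sums\<close>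

lemma rmod_homI:
  assumes "\<And>x. x \<in> carrier M \<Longrightarrow> f x \<in> carrier N"
    "\<And>x y. \<lbrakk>x \<in> carrier M; y \<in> carrier M\<rbrakk> \<Longrightarrow> f (x \<oplus>\<^bsub>M\<^esub> y) = f x \<oplus>\<^bsub>N\<^esub> f y"
    "\<And>x r. \<lbrakk>x \<in> carrier M; r \<in> carrier R\<rbrakk> \<Longrightarrow> f (x \<star>\<^bsub>M\<^esub> r) = f x \<star>\<^bsub>N\<^esub> r"
  shows "f \<in> rmod_hom R M N"
  using assms by (simp add: rmod_hom_def)

lemma rmod_homD:
  assumes "f \<in> rmod_hom R M N"
  shows "x \<in> carrier M \<Longrightarrow> f x \<in> carrier N"
    "\<lbrakk>x \<in> carrier M; y \<in> carrier M\<rbrakk> \<Longrightarrow> f (x \<oplus>\<^bsub>M\<^esub> y) = f x \<oplus>\<^bsub>N\<^esub> f y"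
    "\<lbrakk>x \<in> carrier M; r \<in> carrier R\<rbrakk> \<Longrightarrow> f (x \<star>\<^bsub>M\<^esub> r) = f x \<star>\<^bsub>N\<^esub> r"
  using assms by (auto simp: rmod_hom_def)

lemma rmod_hom_comp:
  assumes "f \<in> rmod_hom R L M" "g \<in> rmod_hom R M N"
  shows "g \<circ> f \<in> rmod_hom R L N"
  using rmod_homD[OF assms(1)] rmod_homD[OF assms(2)] by (intro rmod_homI) simp_all

lemma rmod_hom_zero:
  assumes "f \<in> rmod_hom R M N" "right_module R M" "right_module R N"
  shows "f \<zero>\<^bsub>M\<^esub> = \<zero>\<^bsub>N\<^esub>"
proof -
  interpret M: right_module R M by fact
  interpret N: right_module R N by fact
  have "f \<zero>\<^bsub>M\<^esub> \<oplus>\<^bsub>N\<^esub> f \<zero>\<^bsub>M\<^esub> = f \<zero>\<^bsub>M\<^esub>"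
    using rmod_homD(2)[OF assms(1), of "\<zero>\<^bsub>M\<^esub>" "\<zero>\<^bsub>M\<^esub>"] by simp
  then show ?thesis
    using rmod_homD(1)[OF assms(1) M.M.zero_closed] by (simp add: N.M.add.r_cancel_one)
qed

lemma inv_into_rmod_hom:
  assumes f: "f \<in> rmod_iso R M N" and M: "right_module R M"
  shows "inv_into (carrier M) f \<in> rmod_hom R N M"
proof -
  interpret M: right_module R M by (rule M)
  have f: "f \<in> rmod_hom R M N" and bij: "bij_betw f (carrier M) (carrier N)"
    using f by (auto simp: rmod_iso_def)
  let ?g = "inv_into (carrier M) f"
  have g: "?g y \<in> carrier M" "f (?g y) = y" if "y \<in> carrier N" for y
    using that bij bij_betw_inv_into_right bij_betwE[OF bij_betw_inv_into] by metis+
  have gf: "?g (f x) = x" if "x \<in> carrier M" for x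
    using that bij by (rule bij_betw_inv_into_left[rotated])
  show ?thesis
  proof (rule rmod_homI)
    fix y y' assume y: "y \<in> carrier N" "y' \<in> carrier N"
    show "?g (y \<oplus>\<^bsub>N\<^esub> y') = ?g y \<oplus>\<^bsub>M\<^esub> ?g y'"
      using gf[of "?g y \<oplus>\<^bsub>M\<^esub> ?g y'"] rmod_homD(2)[OF f g(1)[OF y(1)] g(1)[OF y(2)]] g y by simp
  next
    fix y r assume y: "y \<in> carrier N" "r \<in> carrier R"
    show "?g (y \<star>\<^bsub>N\<^esub> r) = ?g y \<star>\<^bsub>M\<^esub> r"
      using gf[of "?g y \<star>\<^bsub>M\<^esub> r"] rmod_homD(3)[OF f g(1)[OF y(1)] y(2)] g y
      by (simp add: M.rsmult_closed)
  qed (rule g)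
qed

lemma rpower_simps [simp]:
  "carrier (rpower R n) = {..<n} \<rightarrow>\<^sub>E carrier R"
  "\<zero>\<^bsub>rpower R n\<^esub> = (\<lambda>i\<in>{..<n}. \<zero>\<^bsub>R\<^esub>)"
  "f \<oplus>\<^bsub>rpower R n\<^esub> g = (\<lambda>i\<in>{..<n}. f i \<oplus>\<^bsub>R\<^esub> g i)"
  "f \<star>\<^bsub>rpower R n\<^esub> r = (\<lambda>i\<in>{..<n}. f i \<otimes>\<^bsub>R\<^esub> r)"
  by (simp_all add: rpower_def)

lemma rpower_nth: "\<lbrakk>f \<in> carrier (rpower R n); i < n\<rbrakk> \<Longrightarrow> f i \<in> carrier R"
  using PiE_mem[of f "{..<n}" "\<lambda>_. carrier R" i] by simp

lemma rpower_eqI: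
  "\<lbrakk>f \<in> carrier (rpower R n); g \<in> carrier (rpower R n); \<And>i. i < n \<Longrightarrow> f i = g i\<rbrakk> \<Longrightarrow> f = g"
  by (rule PiE_ext[where k = "{..<n}" and s = "\<lambda>_. carrier R"]) simp_all

definition unit_vector :: "('a, 'x) ring_scheme \<Rightarrow> nat \<Rightarrow> nat \<Rightarrow> nat \<Rightarrow> 'a" where
  "unit_vector R n i = (\<lambda>k\<in>{..<n}. if k = i then \<one>\<^bsub>R\<^esub> else \<zero>\<^bsub>R\<^esub>)"

lemma rmod_sum_simps [simp]:
  "carrier (rmod_sum M N) = carrier M \<times> carrier N"
  "\<zero>\<^bsub>rmod_sum M N\<^esub> = (\<zero>\<^bsub>M\<^esub>, \<zero>\<^bsub>N\<^esub>)"
  "(x, y) \<oplus>\<^bsub>rmod_sum M N\<^esub> (x', y') = (x \<oplus>\<^bsub>M\<^esub> x', y \<oplus>\<^bsub>N\<^esub> y')"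
  "(x, y) \<star>\<^bsub>rmod_sum M N\<^esub> r = (x \<star>\<^bsub>M\<^esub> r, y \<star>\<^bsub>N\<^esub> r)"
  by (simp_all add: rmod_sum_def)

lemma right_module_sum:
  assumes "right_module R M" "right_module R N"
  shows "right_module R (rmod_sum M N)"
proof -
  interpret M: right_module R M by fact
  interpret N: right_module R N by fact
  have "abelian_group (rmod_sum M N)"
  proof (rule abelian_groupI)
    fix z assume "z \<in> carrier (rmod_sum M N)"
    then show "\<exists>w\<in>carrier (rmod_sum M N). w \<oplus>\<^bsub>rmod_sum M N\<^esub> z = \<zero>\<^bsub>rmod_sum M N\<^esub>"
      by (intro bexI[of _ "(\<ominus>\<^bsub>M\<^esub> fst z, \<ominus>\<^bsub>N\<^esub> snd z)"]) (auto simp: M.M.l_neg N.M.l_neg)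
  qed (auto simp: M.M.a_ac N.M.a_ac)
  then show ?thesis
    by (intro right_module.intro right_module_axioms.intro M.R.ring_axioms)
      (auto simp: M.rsmult_closed N.rsmult_closed M.rsmult_r_distr N.rsmult_r_distr M.rsmult_l_distr
        N.rsmult_l_distr M.rsmult_assoc N.rsmult_assoc M.rsmult_one N.rsmult_one)
qed

context ring
begin

lemma right_module_rpower: "right_module R (rpower R n)"
proof -
  note mem = rpower_nth[where R = R and n = n]
  have "abelian_group (rpower R n)"
  proof (rule abelian_groupI)
    fix f assume f: "f \<in> carrier (rpower R n)"
    then have fi: "f i \<in> carrier R" if "i < n" for i using mem that by simp
    have "(\<lambda>i\<in>{..<n}. \<ominus> f i) \<oplus>\<^bsub>rpower R n\<^esub> f = \<zero>\<^bsub>rpower R n\<^esub>"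
      by (simp, rule restrict_ext, simp add: fi l_neg)
    moreover have "(\<lambda>i\<in>{..<n}. \<ominus> f i) \<in> carrier (rpower R n)"
      by (simp add: fi)
    ultimately show "\<exists>g\<in>carrier (rpower R n). g \<oplus>\<^bsub>rpower R n\<^esub> f = \<zero>\<^bsub>rpower R n\<^esub>"
      by blast
    show "\<zero>\<^bsub>rpower R n\<^esub> \<oplus>\<^bsub>rpower R n\<^esub> f = f"
      by (rule rpower_eqI[where R = R and n = n]) (use f in \<open>simp_all add: fi\<close>)
    fix g assume g: "g \<in> carrier (rpower R n)"
    then have gi: "g i \<in> carrier R" if "i < n" for i using mem that by simp
    show "f \<oplus>\<^bsub>rpower R n\<^esub> g = g \<oplus>\<^bsub>rpower R n\<^esub> f"
      by (simp, rule restrict_ext, simp add: fi gi a_comm)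
    show "f \<oplus>\<^bsub>rpower R n\<^esub> g \<in> carrier (rpower R n)"
      by (simp add: fi gi)
    fix h assume "h \<in> carrier (rpower R n)"
    then have hi: "h i \<in> carrier R" if "i < n" for i using mem that by simp
    show "f \<oplus>\<^bsub>rpower R n\<^esub> g \<oplus>\<^bsub>rpower R n\<^esub> h = f \<oplus>\<^bsub>rpower R n\<^esub> (g \<oplus>\<^bsub>rpower R n\<^esub> h)"
      by (simp, rule restrict_ext, simp add: fi gi hi a_assoc)
  qed simp
  then show ?thesis
  proof (intro right_module.intro right_module_axioms.intro ring_axioms)
    fix f assume f: "f \<in> carrier (rpower R n)"
    then have fi: "f i \<in> carrier R" if "i < n" for i using mem that by simp
    show "f \<star>\<^bsub>rpower R n\<^esub> \<one> = f"
      by (rule rpower_eqI[where R = R and n = n]) (use f in \<open>simp_all add: fi\<close>)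
    fix r assume r: "r \<in> carrier R"
    show "f \<star>\<^bsub>rpower R n\<^esub> r \<in> carrier (rpower R n)"
      by (simp add: fi r)
    fix s assume s: "s \<in> carrier R"
    show "f \<star>\<^bsub>rpower R n\<^esub> (r \<oplus> s) = f \<star>\<^bsub>rpower R n\<^esub> r \<oplus>\<^bsub>rpower R n\<^esub> f \<star>\<^bsub>rpower R n\<^esub> s"
      by (simp, rule restrict_ext, simp add: fi r s r_distr)
    show "f \<star>\<^bsub>rpower R n\<^esub> (r \<otimes> s) = (f \<star>\<^bsub>rpower R n\<^esub> r) \<star>\<^bsub>rpower R n\<^esub> s"
      by (simp, rule restrict_ext, simp add: fi r s m_assoc)
  next
    fix f g r assume "f \<in> carrier (rpower R n)" "g \<in> carrier (rpower R n)" and r: "r \<in> carrier R"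
    then have fi: "f i \<in> carrier R" "g i \<in> carrier R" if "i < n" for i using mem that by simp_all
    show "(f \<oplus>\<^bsub>rpower R n\<^esub> g) \<star>\<^bsub>rpower R n\<^esub> r = f \<star>\<^bsub>rpower R n\<^esub> r \<oplus>\<^bsub>rpower R n\<^esub> g \<star>\<^bsub>rpower R n\<^esub> r"
      by (simp, rule restrict_ext, simp add: fi r l_distr)
  qed
qed

lemma unit_vector_carrier [simp]: "unit_vector R n i \<in> carrier (rpower R n)"
  by (simp add: unit_vector_def)

text \<open>An element of \<open>R\<^sup>n\<close> is the sum of its coordinates times unit vectors; the proof splits off one
  coordinate at a time, the last one first.\<close>

lemma rpower_induct [consumes 1, case_names zero unit add]:
  assumes "v \<in> carrier (rpower R n)" "P \<zero>\<^bsub>rpower R n\<^esub>"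
    "\<And>i a. \<lbrakk>i < n; a \<in> carrier R\<rbrakk> \<Longrightarrow> P (unit_vector R n i \<star>\<^bsub>rpower R n\<^esub> a)"
    "\<And>v w. \<lbrakk>v \<in> carrier (rpower R n); w \<in> carrier (rpower R n); P v; P w\<rbrakk> \<Longrightarrow> P (v \<oplus>\<^bsub>rpower R n\<^esub> w)"
  shows "P v"
proof -
  have "P v" if "k \<le> n" "v \<in> carrier (rpower R n)" "\<And>i. i < n \<Longrightarrow> k \<le> i \<Longrightarrow> v i = \<zero>" for k v
    using that
  proof (induction k arbitrary: v)
    case 0
    then have "v = \<zero>\<^bsub>rpower R n\<^esub>" by (intro rpower_eqI[where R = R and n = n]) simp_all
    then show ?case by (simp only: assms(2))
  next
    case (Suc k)
    let ?w = "v(k := \<zero>)" and ?u = "unit_vector R n k \<star>\<^bsub>rpower R n\<^esub> v k"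
    note vc = rpower_nth[OF Suc.prems(2)]
    have k: "k < n" "v k \<in> carrier R" using Suc.prems vc by auto
    have w: "?w \<in> carrier (rpower R n)"
      using Suc.prems(1,2) vc by (auto simp: PiE_iff extensional_def)
    have "P ?w"
    proof (rule Suc.IH[OF _ w])
      show "?w i = \<zero>" if "i < n" "k \<le> i" for i
        using Suc.prems(3)[of i] that by (cases "i = k") simp_all
    qed (use Suc.prems(1) in simp)
    moreover have "P ?u" using k by (intro assms(3))
    moreover have "?u \<in> carrier (rpower R n)"
      using k by (simp add: unit_vector_def)
    ultimately have "P (?w \<oplus>\<^bsub>rpower R n\<^esub> ?u)"
      using w by (intro assms(4))
    also have "?w \<oplus>\<^bsub>rpower R n\<^esub> ?u = v"
    proof (rule rpower_eqI[where R = R and n = n])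
      show "?w \<oplus>\<^bsub>rpower R n\<^esub> ?u \<in> carrier (rpower R n)"
        using k vc by (simp add: unit_vector_def)
      show "(?w \<oplus>\<^bsub>rpower R n\<^esub> ?u) i = v i" if "i < n" for i
        using k vc[OF that] that by (simp add: unit_vector_def)
    qed (rule Suc.prems(2))
    finally show ?case .
  qed
  from this[OF order_refl assms(1)] show ?thesis by simp
qed

end

text \<open>The copy of a module along an injection of its carrier type, with which modules over \<open>R\<close> are
  moved to the type of the test modules in the definition of faithful flatness.\<close>

definition transport_rmodule :: "('m \<Rightarrow> 'u) \<Rightarrow> ('r, 'm, 'y) rmodule_scheme \<Rightarrow> ('r, 'u) rmodule" where
  "transport_rmodule j M =
    \<lparr>carrier = j ` carrier M, monoid.mult = undefined, one = undefined, ring.zero = j \<zero>\<^bsub>M\<^esub>,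
     add = (\<lambda>x y. j (inv_into UNIV j x \<oplus>\<^bsub>M\<^esub> inv_into UNIV j y)), rsmult = (\<lambda>x r. j (inv_into UNIV j x \<star>\<^bsub>M\<^esub> r))\<rparr>"

lemma transport_rmodule_simps [simp]:
  assumes "inj j"
  shows "carrier (transport_rmodule j M) = j ` carrier M"
    "\<zero>\<^bsub>transport_rmodule j M\<^esub> = j \<zero>\<^bsub>M\<^esub>"
    "j x \<oplus>\<^bsub>transport_rmodule j M\<^esub> j y = j (x \<oplus>\<^bsub>M\<^esub> y)"
    "j x \<star>\<^bsub>transport_rmodule j M\<^esub> r = j (x \<star>\<^bsub>M\<^esub> r)"
  using assms by (simp_all add: transport_rmodule_def)

lemma right_module_transport:
  assumes "inj j" "right_module R M"
  shows "right_module R (transport_rmodule j M)"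
proof -
  interpret M: right_module R M by fact
  note [simp] = transport_rmodule_simps[OF assms(1)]
  have "abelian_group (transport_rmodule j M)"
  proof (rule abelian_groupI)
    fix x assume "x \<in> carrier (transport_rmodule j M)"
    then obtain x' where "x = j x'" "x' \<in> carrier M" by auto
    then show "\<exists>y\<in>carrier (transport_rmodule j M). y \<oplus>\<^bsub>transport_rmodule j M\<^esub> x = \<zero>\<^bsub>transport_rmodule j M\<^esub>"
      by (intro bexI[of _ "j (\<ominus>\<^bsub>M\<^esub> x')"]) (auto simp: M.M.l_neg)
  qed (auto simp: M.M.a_ac)
  then show ?thesis
    by (intro right_module.intro right_module_axioms.intro M.R.ring_axioms)
      (auto simp: M.rsmult_closed M.rsmult_r_distr M.rsmult_l_distr M.rsmult_assoc M.rsmult_one)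
qed


section \<open>The tensor product over a noncommutative ring\<close>

locale tensor_product = M: right_module R M + N: left_module R N
  for R :: "('r, 'x) ring_scheme" and M :: "('r, 'm, 'y) rmodule_scheme"
    and N :: "('r, 'n, 'z) module_scheme"
begin

abbreviation F where "F \<equiv> free_Abelian_group (carrier M \<times> carrier N)"
abbreviation T where "T \<equiv> tensor_kernel R M N"
abbreviation MN where "MN \<equiv> tensor_group R M N"
abbreviation pure (infixl "\<boxtimes>" 70) where "x \<boxtimes> y \<equiv> pure_tensor R M N x y"

sublocale F: comm_group F
  by (rule abelian_free_Abelian_group)

lemma frag_diff_carrier:
  assumes "a \<in> carrier M \<times> carrier N" "b \<in> carrier M \<times> carrier N"
  shows "frag_of a - frag_of b \<in> carrier F"
  using keys_diff[of "frag_of a" "frag_of b"] assms by auto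

lemma frag_diff2_carrier:
  assumes "a \<in> carrier M \<times> carrier N" "b \<in> carrier M \<times> carrier N" "c \<in> carrier M \<times> carrier N"
  shows "frag_of a - frag_of b - frag_of c \<in> carrier F"
  using keys_diff[of "frag_of a - frag_of b" "frag_of c"] keys_diff[of "frag_of a" "frag_of b"] assms
  by auto

lemma relators_carrier: "tensor_relators R M N \<subseteq> carrier F"
  unfolding tensor_relators_def
  using frag_diff_carrier frag_diff2_carrier M.rsmult_closed N.smult_closed M.M.a_closed N.M.a_closed
  by (auto simp del: carrier_free_Abelian_group_iff)

lemma kernel_subgroup: "subgroup T F"
  unfolding tensor_kernel_def by (rule F.generate_is_subgroup[OF relators_carrier])

lemma kernel_normal: "T \<lhd> F"
  using kernel_subgroup by (simp add: F.normal_iff_subgroup)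

lemma relator_kernel: "u \<in> tensor_relators R M N \<Longrightarrow> u \<in> T"
  unfolding tensor_kernel_def by (rule generate.incl)

sublocale MN: comm_group MN
  unfolding tensor_group_def by (rule F.abelian_FactGroup[OF kernel_subgroup])

lemma coset_carrier: "u \<in> carrier F \<Longrightarrow> T #>\<^bsub>F\<^esub> u \<in> carrier MN"
  unfolding tensor_group_def carrier_FactGroup by (rule imageI)

lemma coset_add:
  "u \<in> carrier F \<Longrightarrow> v \<in> carrier F \<Longrightarrow> (T #>\<^bsub>F\<^esub> u) \<otimes>\<^bsub>MN\<^esub> (T #>\<^bsub>F\<^esub> v) = T #>\<^bsub>F\<^esub> (u + v)"
  using normal.rcos_sum[OF kernel_normal, of u v] by (simp add: tensor_group_def)

lemma one_MN: "\<one>\<^bsub>MN\<^esub> = T"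
  by (simp add: tensor_group_def)

lemma coset_eq:
  assumes "u \<in> carrier F" "v \<in> carrier F" "u - v \<in> T"
  shows "T #>\<^bsub>F\<^esub> u = T #>\<^bsub>F\<^esub> v"
proof -
  have uv: "u - v \<in> carrier F" using assms(3) subgroup.subset[OF kernel_subgroup] by blast
  have "T #>\<^bsub>F\<^esub> (u - v) = T"
    using F.coset_join2[OF uv kernel_subgroup assms(3)] .
  then have "T #>\<^bsub>F\<^esub> u = T \<otimes>\<^bsub>MN\<^esub> (T #>\<^bsub>F\<^esub> v)"
    using coset_add[OF uv assms(2)] by simp
  then show ?thesis
    using coset_carrier[OF assms(2)] by (simp flip: one_MN)
qed

lemma coset_eq_add:
  assumes "u \<in> carrier F" "v \<in> carrier F" "w \<in> carrier F" "u - v - w \<in> T"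
  shows "T #>\<^bsub>F\<^esub> u = (T #>\<^bsub>F\<^esub> v) \<otimes>\<^bsub>MN\<^esub> (T #>\<^bsub>F\<^esub> w)"
  using coset_eq[of u "v + w"] coset_add[of v w] F.m_closed[of v w] assms by (simp add: diff_diff_eq)

lemma pure_carrier [simp]: "\<lbrakk>x \<in> carrier M; y \<in> carrier N\<rbrakk> \<Longrightarrow> x \<boxtimes> y \<in> carrier MN"
  unfolding pure_tensor_def by (rule coset_carrier) simp

lemma pure_add_left:
  assumes "x \<in> carrier M" "x' \<in> carrier M" "y \<in> carrier N"
  shows "(x \<oplus>\<^bsub>M\<^esub> x') \<boxtimes> y = x \<boxtimes> y \<otimes>\<^bsub>MN\<^esub> (x' \<boxtimes> y)"
proof -
  have "frag_of (x \<oplus>\<^bsub>M\<^esub> x', y) - frag_of (x, y) - frag_of (x', y) \<in> T"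
    using assms by (intro relator_kernel) (auto simp: tensor_relators_def)
  then show ?thesis
    using assms unfolding pure_tensor_def by (intro coset_eq_add) auto
qed

lemma pure_add_right:
  assumes "x \<in> carrier M" "y \<in> carrier N" "y' \<in> carrier N"
  shows "x \<boxtimes> (y \<oplus>\<^bsub>N\<^esub> y') = x \<boxtimes> y \<otimes>\<^bsub>MN\<^esub> (x \<boxtimes> y')"
proof -
  have "frag_of (x, y \<oplus>\<^bsub>N\<^esub> y') - frag_of (x, y) - frag_of (x, y') \<in> T"
    using assms by (intro relator_kernel) (auto simp: tensor_relators_def)
  then show ?thesis
    using assms unfolding pure_tensor_def by (intro coset_eq_add) auto
qed

lemma pure_balanced:
  assumes "x \<in> carrier M" "r \<in> carrier R" "y \<in> carrier N"
  shows "(x \<star>\<^bsub>M\<^esub> r) \<boxtimes> y = x \<boxtimes> (r \<odot>\<^bsub>N\<^esub> y)"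
proof -
  have "frag_of (x \<star>\<^bsub>M\<^esub> r, y) - frag_of (x, r \<odot>\<^bsub>N\<^esub> y) \<in> T"
    using assms by (intro relator_kernel) (auto simp: tensor_relators_def)
  then show ?thesis
    using assms M.rsmult_closed N.smult_closed unfolding pure_tensor_def
    by (intro coset_eq) auto
qed

lemma pure_zero_left: "y \<in> carrier N \<Longrightarrow> \<zero>\<^bsub>M\<^esub> \<boxtimes> y = \<one>\<^bsub>MN\<^esub>"
  using pure_add_left[of "\<zero>\<^bsub>M\<^esub>" "\<zero>\<^bsub>M\<^esub>" y] MN.r_cancel_one'[of "\<zero>\<^bsub>M\<^esub> \<boxtimes> y" "\<zero>\<^bsub>M\<^esub> \<boxtimes> y"]
  by simp

lemma pure_zero_right: "x \<in> carrier M \<Longrightarrow> x \<boxtimes> \<zero>\<^bsub>N\<^esub> = \<one>\<^bsub>MN\<^esub>"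
  using pure_add_right[of x "\<zero>\<^bsub>N\<^esub>" "\<zero>\<^bsub>N\<^esub>"] MN.r_cancel_one'[of "x \<boxtimes> \<zero>\<^bsub>N\<^esub>" "x \<boxtimes> \<zero>\<^bsub>N\<^esub>"]
  by simp

text \<open>Pure tensors generate the group, and they are closed under inverses because
  \<open>- (x \<otimes> y) = (- x) \<otimes> y\<close>; hence sums suffice, and the inductive step for inverses disappears.\<close>

lemma tensor_induct [consumes 1, case_names pure add]:
  assumes U: "U \<in> carrier MN"
    and pure: "\<And>x y. \<lbrakk>x \<in> carrier M; y \<in> carrier N\<rbrakk> \<Longrightarrow> P (x \<boxtimes> y)"
    and add: "\<And>U V. \<lbrakk>U \<in> carrier MN; V \<in> carrier MN; P U; P V\<rbrakk> \<Longrightarrow> P (U \<otimes>\<^bsub>MN\<^esub> V)"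
  shows "P U"
proof -
  obtain u where u: "u \<in> carrier F" "U = T #>\<^bsub>F\<^esub> u"
    using U by (auto simp: tensor_group_def carrier_FactGroup)
  have "P (T #>\<^bsub>F\<^esub> u) \<and> P (T #>\<^bsub>F\<^esub> (- u))"
  proof (rule free_Abelian_group_induct[where P = "\<lambda>u. P (T #>\<^bsub>F\<^esub> u) \<and> P (T #>\<^bsub>F\<^esub> (- u))"])
    show "Poly_Mapping.keys u \<subseteq> carrier M \<times> carrier N" using u by simp
    have "T #>\<^bsub>F\<^esub> 0 = T"
      using F.coset_mult_one[OF subgroup.subset[OF kernel_subgroup]] by simp
    moreover have "P T"
      using pure[of "\<zero>\<^bsub>M\<^esub>" "\<zero>\<^bsub>N\<^esub>"] pure_zero_left[of "\<zero>\<^bsub>N\<^esub>"] by (simp add: one_MN)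
    ultimately show "P (T #>\<^bsub>F\<^esub> 0) \<and> P (T #>\<^bsub>F\<^esub> (- 0))" by simp
  next
    fix v w assume vw: "Poly_Mapping.keys v \<subseteq> carrier M \<times> carrier N" "Poly_Mapping.keys w \<subseteq> carrier M \<times> carrier N"
      "P (T #>\<^bsub>F\<^esub> v) \<and> P (T #>\<^bsub>F\<^esub> (- v))" "P (T #>\<^bsub>F\<^esub> w) \<and> P (T #>\<^bsub>F\<^esub> (- w))"
    then have c: "v \<in> carrier F" "w \<in> carrier F" "- v \<in> carrier F" "- w \<in> carrier F"
      by (simp_all add: keys_minus)
    show "P (T #>\<^bsub>F\<^esub> (v - w)) \<and> P (T #>\<^bsub>F\<^esub> (- (v - w)))"
      using add[OF coset_carrier[OF c(1)] coset_carrier[OF c(4)]]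
        add[OF coset_carrier[OF c(3)] coset_carrier[OF c(2)]] vw(3,4)
      by (simp add: coset_add[OF c(1,4)] coset_add[OF c(3,2)])
  next
    fix a assume "a \<in> carrier M \<times> carrier N"
    then obtain x y where a: "a = (x, y)" and x: "x \<in> carrier M" and y: "y \<in> carrier N" by blast
    have "T #>\<^bsub>F\<^esub> (- frag_of a) = (\<ominus>\<^bsub>M\<^esub> x) \<boxtimes> y"
    proof -
      have c: "frag_of a \<in> carrier F" "- frag_of a \<in> carrier F" using x y a by (auto simp: keys_minus)
      have "T #>\<^bsub>F\<^esub> 0 = T"
        using F.coset_mult_one[OF subgroup.subset[OF kernel_subgroup]] by simp
      then have "(T #>\<^bsub>F\<^esub> (- frag_of a)) \<otimes>\<^bsub>MN\<^esub> (T #>\<^bsub>F\<^esub> frag_of a) = \<one>\<^bsub>MN\<^esub>"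
        by (simp add: coset_add[OF c(2,1)] one_MN)
      moreover have "(\<ominus>\<^bsub>M\<^esub> x) \<boxtimes> y \<otimes>\<^bsub>MN\<^esub> (T #>\<^bsub>F\<^esub> frag_of a) = \<one>\<^bsub>MN\<^esub>"
        using pure_add_left[of "\<ominus>\<^bsub>M\<^esub> x" x y] x y pure_zero_left[OF y]
        by (simp add: a pure_tensor_def M.M.l_neg)
      ultimately show ?thesis
        using MN.right_cancel[of "T #>\<^bsub>F\<^esub> frag_of a" "T #>\<^bsub>F\<^esub> (- frag_of a)" "(\<ominus>\<^bsub>M\<^esub> x) \<boxtimes> y"]
          coset_carrier[OF c(1)] coset_carrier[OF c(2)] x y by simp
    qed
    then show "P (T #>\<^bsub>F\<^esub> frag_of a) \<and> P (T #>\<^bsub>F\<^esub> (- frag_of a))"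
      using pure[OF x y] pure[of "\<ominus>\<^bsub>M\<^esub> x" y] x y by (simp add: a pure_tensor_def)
  qed
  then show ?thesis using u by simp
qed

text \<open>The universal property: the linear extension of \<open>f\<close> to the free group on the pairs kills the
  relators, hence the subgroup that they generate, and so descends to the quotient.\<close>

lemma tensor_lift:
  assumes H: "comm_group H"
    and closed: "\<And>x y. \<lbrakk>x \<in> carrier M; y \<in> carrier N\<rbrakk> \<Longrightarrow> f x y \<in> carrier H"
    and add_left: "\<And>x x' y. \<lbrakk>x \<in> carrier M; x' \<in> carrier M; y \<in> carrier N\<rbrakk>
      \<Longrightarrow> f (x \<oplus>\<^bsub>M\<^esub> x') y = f x y \<otimes>\<^bsub>H\<^esub> f x' y"
    and add_right: "\<And>x y y'. \<lbrakk>x \<in> carrier M; y \<in> carrier N; y' \<in> carrier N\<rbrakk>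
      \<Longrightarrow> f x (y \<oplus>\<^bsub>N\<^esub> y') = f x y \<otimes>\<^bsub>H\<^esub> f x y'"
    and balanced: "\<And>x r y. \<lbrakk>x \<in> carrier M; r \<in> carrier R; y \<in> carrier N\<rbrakk>
      \<Longrightarrow> f (x \<star>\<^bsub>M\<^esub> r) y = f x (r \<odot>\<^bsub>N\<^esub> y)"
  obtains g where "g \<in> hom MN H" "\<And>x y. \<lbrakk>x \<in> carrier M; y \<in> carrier N\<rbrakk> \<Longrightarrow> g (x \<boxtimes> y) = f x y"
proof -
  interpret H: comm_group H by (rule H)
  have "(\<lambda>(x, y). f x y) ` (carrier M \<times> carrier N) \<subseteq> carrier H"
    using closed by auto
  then obtain h where h: "h \<in> hom F H" "\<And>x. x \<in> carrier M \<times> carrier N \<Longrightarrow> h (frag_of x) = (case x of (x, y) \<Rightarrow> f x y)"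
    using H.free_Abelian_group_universal by metis
  interpret h: group_hom F H h
    using h(1) by unfold_locales
  have h_diff: "h (u - v) = h u \<otimes>\<^bsub>H\<^esub> inv\<^bsub>H\<^esub> h v" if "u \<in> carrier F" "v \<in> carrier F" for u v
    using that h.hom_mult[of u "inv\<^bsub>F\<^esub> v"] by (simp add: keys_minus h.hom_inv[symmetric])
  have cancel: "p \<otimes>\<^bsub>H\<^esub> q \<otimes>\<^bsub>H\<^esub> inv\<^bsub>H\<^esub> p \<otimes>\<^bsub>H\<^esub> inv\<^bsub>H\<^esub> q = \<one>\<^bsub>H\<^esub>" if "p \<in> carrier H" "q \<in> carrier H" for p q
    using that by (simp add: H.m_comm[of p q] H.m_assoc)
  have "tensor_relators R M N \<subseteq> kernel F H h"
  proof
    fix u assume u: "u \<in> tensor_relators R M N"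
    then consider
      x x' y where "u = frag_of (x \<oplus>\<^bsub>M\<^esub> x', y) - frag_of (x, y) - frag_of (x', y)"
        "x \<in> carrier M" "x' \<in> carrier M" "y \<in> carrier N"
    | x y y' where "u = frag_of (x, y \<oplus>\<^bsub>N\<^esub> y') - frag_of (x, y) - frag_of (x, y')"
        "x \<in> carrier M" "y \<in> carrier N" "y' \<in> carrier N"
    | x r y where "u = frag_of (x \<star>\<^bsub>M\<^esub> r, y) - frag_of (x, r \<odot>\<^bsub>N\<^esub> y)"
        "x \<in> carrier M" "r \<in> carrier R" "y \<in> carrier N"
      unfolding tensor_relators_def by blast
    then have "h u = \<one>\<^bsub>H\<^esub>"
    proof cases
      case 1
      then show ?thesis
        using frag_diff_carrier[of "(x \<oplus>\<^bsub>M\<^esub> x', y)" "(x, y)"]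
        by (simp add: h_diff h(2) add_left closed cancel)
    next
      case 2
      then show ?thesis
        using frag_diff_carrier[of "(x, y \<oplus>\<^bsub>N\<^esub> y')" "(x, y)"]
        by (simp add: h_diff h(2) add_right closed cancel)
    next
      case 3
      then show ?thesis
        using M.rsmult_closed N.smult_closed by (simp add: h_diff h(2) balanced closed)
    qed
    then show "u \<in> kernel F H h"
      using subsetD[OF relators_carrier u] unfolding kernel_def by blast
  qed
  then have ker: "T \<subseteq> kernel F H h"
    unfolding tensor_kernel_def by (rule F.generate_subgroup_incl[OF _ h.subgroup_kernel])
  have "h u = h v" if uv: "u \<in> carrier F" "v \<in> carrier F" "T #>\<^bsub>F\<^esub> u = T #>\<^bsub>F\<^esub> v" for u v
  proof -
    have "u \<in> T #>\<^bsub>F\<^esub> v"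
      using F.rcos_self[OF uv(1) kernel_subgroup] uv(3) by simp
    then obtain t where "t \<in> T" "u = t + v" by (auto simp: r_coset_def)
    then have "t \<in> carrier F" "h t = \<one>\<^bsub>H\<^esub>" "u = t \<otimes>\<^bsub>F\<^esub> v" using ker by (auto simp: kernel_def)
    then show ?thesis using uv h.hom_mult[of t v] by simp
  qed
  from FactGroup_universal[OF h(1) kernel_normal this]
  obtain g where g: "g \<in> hom (F Mod T) H" "\<And>u. u \<in> carrier F \<Longrightarrow> g (T #>\<^bsub>F\<^esub> u) = h u" by blast
  have "g (x \<boxtimes> y) = f x y" if "x \<in> carrier M" "y \<in> carrier N" for x y
    using g(2)[of "frag_of (x, y)"] h(2)[of "(x, y)"] that by (simp add: pure_tensor_def)
  with g(1) that show thesis by (simp add: tensor_group_def)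
qed

end

text \<open>The universal property yields a homomorphism \<open>h\<close> with the right values on pure tensors.  The
  coset formula that defines \<open>tensor_map\<close> agrees with \<open>h\<close> because both come from the same map between
  the free groups.\<close>

lemma tensor_map_hom:
  assumes "tensor_product R M N" "tensor_product R M' N'"
    and f: "\<And>x. x \<in> carrier M \<Longrightarrow> f x \<in> carrier M'"
      "\<And>x x'. \<lbrakk>x \<in> carrier M; x' \<in> carrier M\<rbrakk> \<Longrightarrow> f (x \<oplus>\<^bsub>M\<^esub> x') = f x \<oplus>\<^bsub>M'\<^esub> f x'"
      "\<And>x r. \<lbrakk>x \<in> carrier M; r \<in> carrier R\<rbrakk> \<Longrightarrow> f (x \<star>\<^bsub>M\<^esub> r) = f x \<star>\<^bsub>M'\<^esub> r"
    and g: "\<And>y. y \<in> carrier N \<Longrightarrow> g y \<in> carrier N'"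
      "\<And>y y'. \<lbrakk>y \<in> carrier N; y' \<in> carrier N\<rbrakk> \<Longrightarrow> g (y \<oplus>\<^bsub>N\<^esub> y') = g y \<oplus>\<^bsub>N'\<^esub> g y'"
      "\<And>y r. \<lbrakk>y \<in> carrier N; r \<in> carrier R\<rbrakk> \<Longrightarrow> g (r \<odot>\<^bsub>N\<^esub> y) = r \<odot>\<^bsub>N'\<^esub> g y"
  shows "tensor_map R M' N' f g \<in> hom (tensor_group R M N) (tensor_group R M' N')"
    and "\<And>x y. \<lbrakk>x \<in> carrier M; y \<in> carrier N\<rbrakk> \<Longrightarrow>
      tensor_map R M' N' f g (pure_tensor R M N x y) = pure_tensor R M' N' (f x) (g y)"
proof -
  interpret D: tensor_product R M N by fact
  interpret E: tensor_product R M' N' by fact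
  let ?e = "frag_extend (\<lambda>(x, y). frag_of (f x, g y))"
  obtain h where h: "h \<in> hom D.MN E.MN"
    "\<And>x y. \<lbrakk>x \<in> carrier M; y \<in> carrier N\<rbrakk> \<Longrightarrow> h (D.pure x y) = E.pure (f x) (g y)"
    by (rule D.tensor_lift[OF E.MN.comm_group_axioms, of "\<lambda>x y. E.pure (f x) (g y)"])
      (auto simp: f g E.pure_add_left E.pure_add_right E.pure_balanced)
  interpret h: group_hom D.MN E.MN h
    using h(1) by unfold_locales
  have e: "?e u \<in> carrier E.F \<and> h (D.T #>\<^bsub>D.F\<^esub> u) = E.T #>\<^bsub>E.F\<^esub> ?e u" if "u \<in> carrier D.F" for u
  proof (rule free_Abelian_group_induct[where P = "\<lambda>u. ?e u \<in> carrier E.F \<and> h (D.T #>\<^bsub>D.F\<^esub> u) = E.T #>\<^bsub>E.F\<^esub> ?e u"])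
    show "Poly_Mapping.keys u \<subseteq> carrier M \<times> carrier N" using that by simp
    show "?e 0 \<in> carrier E.F \<and> h (D.T #>\<^bsub>D.F\<^esub> 0) = E.T #>\<^bsub>E.F\<^esub> ?e 0"
      using h.hom_one D.F.coset_mult_one[OF subgroup.subset[OF D.kernel_subgroup]]
        E.F.coset_mult_one[OF subgroup.subset[OF E.kernel_subgroup]]
      by (simp add: D.one_MN E.one_MN)
  next
    fix v w
    assume vw: "Poly_Mapping.keys v \<subseteq> carrier M \<times> carrier N" "Poly_Mapping.keys w \<subseteq> carrier M \<times> carrier N"
      "?e v \<in> carrier E.F \<and> h (D.T #>\<^bsub>D.F\<^esub> v) = E.T #>\<^bsub>E.F\<^esub> ?e v"
      "?e w \<in> carrier E.F \<and> h (D.T #>\<^bsub>D.F\<^esub> w) = E.T #>\<^bsub>E.F\<^esub> ?e w"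
    have vF: "v \<in> carrier D.F" "w \<in> carrier D.F" "v - w \<in> carrier D.F"
      using vw(1,2) keys_diff[of v w] by auto
    have eF: "?e v \<in> carrier E.F" "?e w \<in> carrier E.F" "?e (v - w) \<in> carrier E.F"
      using vw keys_diff[of "?e v" "?e w"] by (auto simp: frag_extend_diff)
    have "h (D.T #>\<^bsub>D.F\<^esub> (v - w)) \<otimes>\<^bsub>E.MN\<^esub> (E.T #>\<^bsub>E.F\<^esub> ?e w) = E.T #>\<^bsub>E.F\<^esub> ?e v"
      using h.hom_mult[of "D.T #>\<^bsub>D.F\<^esub> (v - w)" "D.T #>\<^bsub>D.F\<^esub> w"] vw(3,4) vF D.coset_carrier
        D.coset_add[OF vF(3,2)] by simp
    also have "E.T #>\<^bsub>E.F\<^esub> ?e v = (E.T #>\<^bsub>E.F\<^esub> ?e (v - w)) \<otimes>\<^bsub>E.MN\<^esub> (E.T #>\<^bsub>E.F\<^esub> ?e w)"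
      using E.coset_add[OF eF(3,2)] by (simp add: frag_extend_diff)
    finally show "?e (v - w) \<in> carrier E.F \<and> h (D.T #>\<^bsub>D.F\<^esub> (v - w)) = E.T #>\<^bsub>E.F\<^esub> ?e (v - w)"
      using eF E.coset_carrier h.hom_closed[OF D.coset_carrier[OF vF(3)]] by (simp only: E.MN.right_cancel)
  next
    fix a assume "a \<in> carrier M \<times> carrier N"
    then show "?e (frag_of a) \<in> carrier E.F \<and> h (D.T #>\<^bsub>D.F\<^esub> frag_of a) = E.T #>\<^bsub>E.F\<^esub> ?e (frag_of a)"
      using h(2) f(1) g(1) by (auto simp: pure_tensor_def)
  qed
  have eT: "?e t \<in> E.T" if "t \<in> D.T" for t
  proof -
    have t: "t \<in> carrier D.F" using that subgroup.subset[OF D.kernel_subgroup] by blast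
    have "D.T #>\<^bsub>D.F\<^esub> t = D.T" by (rule D.F.coset_join2[OF t D.kernel_subgroup that])
    then have "E.T #>\<^bsub>E.F\<^esub> ?e t = E.T"
      using e[OF t] h.hom_one by (simp add: D.one_MN E.one_MN)
    then show ?thesis
      using e[OF t] E.F.coset_join1[OF _ _ E.kernel_subgroup] E.F.rcos_self[OF _ E.kernel_subgroup] by blast
  qed
  have map: "tensor_map R M' N' f g U = h U" if U: "U \<in> carrier D.MN" for U
  proof -
    obtain u where u: "u \<in> carrier D.F" "U = D.T #>\<^bsub>D.F\<^esub> u"
      using U by (auto simp: tensor_group_def carrier_FactGroup)
    have sub: "s + t \<in> E.T" if "s \<in> E.T" "t \<in> E.T" for s t
      using subgroup.m_closed[OF E.kernel_subgroup that] by simp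
    have zero: "0 \<in> D.T" using subgroup.one_closed[OF D.kernel_subgroup] by simp
    have "tensor_map R M' N' f g U = (\<Union>s\<in>E.T. \<Union>t\<in>D.T. {s + ?e (t + u)})"
      unfolding tensor_map_def u(2) set_mult_def r_coset_def by simp
    also have "\<dots> = (\<Union>s\<in>E.T. {s + ?e u})"
    proof (intro equalityI subsetI)
      fix z assume "z \<in> (\<Union>s\<in>E.T. \<Union>t\<in>D.T. {s + ?e (t + u)})"
      then obtain s t where st: "s \<in> E.T" "t \<in> D.T" "z = (s + ?e t) + ?e u"
        by (auto simp: frag_extend_add add.assoc)
      then show "z \<in> (\<Union>s\<in>E.T. {s + ?e u})"
        using sub[OF st(1) eT[OF st(2)]] by blast
    next
      fix z assume "z \<in> (\<Union>s\<in>E.T. {s + ?e u})"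
      then obtain s where "s \<in> E.T" "z = s + ?e (0 + u)" by auto
      then show "z \<in> (\<Union>s\<in>E.T. \<Union>t\<in>D.T. {s + ?e (t + u)})"
        using zero by blast
    qed
    also have "\<dots> = E.T #>\<^bsub>E.F\<^esub> ?e u"
      unfolding r_coset_def by simp
    finally have "tensor_map R M' N' f g U = E.T #>\<^bsub>E.F\<^esub> ?e u" .
    then show ?thesis using e[OF u(1)] u(2) by simp
  qed
  show "tensor_map R M' N' f g \<in> hom D.MN E.MN"
    using map h.hom_closed h.hom_mult by (intro homI) simp_all
  show "tensor_map R M' N' f g (D.pure x y) = E.pure (f x) (g y)"
    if "x \<in> carrier M" "y \<in> carrier N" for x y
    using map h(2) that by simp
qed


section \<open>Flatness and the multiplication map of a right ideal\<close>

lemma ring_lmodule_simps [simp]: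
  "carrier (ring_lmodule R) = carrier R" "add (ring_lmodule R) = add R"
  "\<zero>\<^bsub>ring_lmodule R\<^esub> = \<zero>\<^bsub>R\<^esub>" "smult (ring_lmodule R) = monoid.mult R"
  by (simp_all add: ring_lmodule_def)

lemma (in ring) right_ideal_zero: "right_ideal {\<zero>} R"
  by (intro right_ideal.intro right_ideal_axioms.intro ring_axioms)
    (simp_all add: additive_subgroup.intro add.triv_subgroup)

text \<open>For a flat module \<open>N\<close> and a right ideal \<open>I\<close>, the map \<open>m\<close> from \<open>I \<otimes> N\<close> to \<open>N\<close> that sends \<open>x \<otimes> y\<close> to \<open>xy\<close> is
  injective: it is the composite of \<open>I \<otimes> N \<rightarrow> R \<otimes> N\<close>, injective by flatness applied to the exact
  sequence \<open>0 \<rightarrow> I \<rightarrow> R\<close>, with the isomorphism \<open>R \<otimes> N \<cong> N\<close>.  The injection \<open>j\<close> supplies copies of the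
  three modules on the type of the test modules.\<close>

lemma flat_mult_injective:
  fixes j :: "'r \<Rightarrow> 'u" and R :: "('r, 'x) ring_scheme" and N :: "('r, 'n, 'z) module_scheme"
  assumes flat: "faithfully_flat TYPE('u) R N" and j: "inj j" and I: "right_ideal I R"
    and m: "m \<in> hom (tensor_group R (rideal_rmodule R I) N) (add_monoid N)"
      "\<And>x y. \<lbrakk>x \<in> I; y \<in> carrier N\<rbrakk> \<Longrightarrow> m (pure_tensor R (rideal_rmodule R I) N x y) = x \<odot>\<^bsub>N\<^esub> y"
    and U: "U \<in> carrier (tensor_group R (rideal_rmodule R I) N)" "m U = \<zero>\<^bsub>N\<^esub>"
  shows "U = \<one>\<^bsub>tensor_group R (rideal_rmodule R I) N\<^esub>"
proof -
  interpret I: right_ideal I R by (rule I)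
  interpret N: left_module R N using flat by (simp add: faithfully_flat_def)
  note [simp] = transport_rmodule_simps[OF j] inv_f_f[OF j]
  let ?Z = "transport_rmodule j (rideal_rmodule R {\<zero>\<^bsub>R\<^esub>})"
    and ?I = "transport_rmodule j (rideal_rmodule R I)"
    and ?R = "transport_rmodule j (rideal_rmodule R (carrier R))"
  have modules: "right_module R ?Z" "right_module R ?I" "right_module R ?R"
    by (intro right_module_transport[OF j] right_ideal.right_module_rideal
      I.right_ideal_zero I I.right_ideal_carrier)+
  interpret D: tensor_product R "rideal_rmodule R I" N
    by (intro tensor_product.intro I.right_module_rideal N.left_module_axioms)
  interpret DZ: tensor_product R ?Z N
    by (intro tensor_product.intro modules N.left_module_axioms)
  interpret DI: tensor_product R ?I N
    by (intro tensor_product.intro modules N.left_module_axioms)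
  interpret DR: tensor_product R ?R N
    by (intro tensor_product.intro modules N.left_module_axioms)
  have incl: "(\<lambda>x. x) \<in> rmod_hom R ?Z ?I" "(\<lambda>x. x) \<in> rmod_hom R ?I ?R"
    by (intro rmod_homI; auto)+
  have "(\<lambda>x. x) ` carrier ?Z = a_kernel ?I ?R (\<lambda>x. x)"
    by (auto simp: a_kernel_def')
  then have exact: "tensor_map R ?I N (\<lambda>x. x) (\<lambda>y. y) ` carrier DZ.MN =
      kernel DI.MN DR.MN (tensor_map R ?R N (\<lambda>x. x) (\<lambda>y. y))"
    using flat modules incl unfolding faithfully_flat_def by blast

  have i: "tensor_map R ?I N (\<lambda>x. x) (\<lambda>y. y) \<in> hom DZ.MN DI.MN"
    by (rule tensor_map_hom[OF DZ.tensor_product_axioms DI.tensor_product_axioms]) auto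
  interpret i: group_hom DZ.MN DI.MN "tensor_map R ?I N (\<lambda>x. x) (\<lambda>y. y)"
    using i by unfold_locales
  have "V = \<one>\<^bsub>DZ.MN\<^esub>" if "V \<in> carrier DZ.MN" for V
    using that
  proof (induction rule: DZ.tensor_induct)
    case (pure x y)
    then show ?case using DZ.pure_zero_left[of y] by simp
  qed simp
  then have "tensor_map R ?I N (\<lambda>x. x) (\<lambda>y. y) ` carrier DZ.MN \<subseteq> {\<one>\<^bsub>DI.MN\<^esub>}"
    using i.hom_one by force
  then have ker: "V = \<one>\<^bsub>DI.MN\<^esub>"
    if "V \<in> carrier DI.MN" "tensor_map R ?R N (\<lambda>x. x) (\<lambda>y. y) V = \<one>\<^bsub>DR.MN\<^esub>" for V
    using exact that by (auto simp: kernel_def)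

  let ?e = "tensor_map R ?R N (\<lambda>x. x) (\<lambda>y. y)"
  have e: "?e \<in> hom DI.MN DR.MN"
    by (rule tensor_map_hom[OF DI.tensor_product_axioms DR.tensor_product_axioms]) auto
  have e_pure: "?e (DI.pure (j x) y) = DR.pure (j x) y" if "x \<in> I" "y \<in> carrier N" for x y
    by (rule tensor_map_hom[OF DI.tensor_product_axioms DR.tensor_product_axioms]) (use that in auto)
  let ?t = "tensor_map R ?I N j (\<lambda>y. y)"
  have t: "?t \<in> hom D.MN DI.MN"
    by (rule tensor_map_hom[OF D.tensor_product_axioms DI.tensor_product_axioms]) auto
  have t_pure: "?t (D.pure x y) = DI.pure (j x) y" if "x \<in> I" "y \<in> carrier N" for x y
    by (rule tensor_map_hom[OF D.tensor_product_axioms DI.tensor_product_axioms]) (use that in auto)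
  let ?s = "tensor_map R (rideal_rmodule R I) N (inv_into UNIV j) (\<lambda>y. y)"
  have s: "?s \<in> hom DI.MN D.MN"
    by (rule tensor_map_hom[OF DI.tensor_product_axioms D.tensor_product_axioms]) auto
  have s_pure: "?s (DI.pure (j x) y) = D.pure x y" if "x \<in> I" "y \<in> carrier N" for x y
  proof -
    have "?s (DI.pure (j x) y) = D.pure (inv_into UNIV j (j x)) y"
      by (rule tensor_map_hom(2)[OF DI.tensor_product_axioms D.tensor_product_axioms]) (use that in auto)
    then show ?thesis by simp
  qed
  interpret e: group_hom DI.MN DR.MN ?e using e by unfold_locales
  interpret t: group_hom D.MN DI.MN ?t using t by unfold_locales
  interpret s: group_hom DI.MN D.MN ?s using s by unfold_locales
  \<comment> \<open>The map \<open>s\<close> shows that passing from \<open>I \<otimes> N\<close> to its copy by \<open>t\<close> loses nothing.\<close>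
  have st: "?s (?t V) = V" if "V \<in> carrier D.MN" for V
    using that by (induction rule: D.tensor_induct) (simp_all add: t_pure s_pure)

  have NG: "comm_group (add_monoid N)" by (rule N.M.a_comm_group)
  \<comment> \<open>The map \<open>\<mu>\<close> is the isomorphism from \<open>R \<otimes> N\<close> onto \<open>N\<close>; it is injective because every tensor in \<open>R \<otimes> N\<close> has the form \<open>1 \<otimes> y\<close>.\<close>
  obtain \<mu> where \<mu>: "\<mu> \<in> hom DR.MN (add_monoid N)"
    "\<And>x y. \<lbrakk>x \<in> carrier ?R; y \<in> carrier N\<rbrakk> \<Longrightarrow> \<mu> (DR.pure x y) = inv_into UNIV j x \<odot>\<^bsub>N\<^esub> y"
    by (rule DR.tensor_lift[OF NG, of "\<lambda>x y. inv_into UNIV j x \<odot>\<^bsub>N\<^esub> y"])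
      (auto simp: N.smult_closed N.smult_l_distr N.smult_r_distr N.smult_assoc)
  have \<mu>_add: "\<mu> (V \<otimes>\<^bsub>DR.MN\<^esub> W) = \<mu> V \<oplus>\<^bsub>N\<^esub> \<mu> W" if "V \<in> carrier DR.MN" "W \<in> carrier DR.MN" for V W
    using hom_mult[OF \<mu>(1) that] by simp
  have m_add: "m (V \<otimes>\<^bsub>D.MN\<^esub> W) = m V \<oplus>\<^bsub>N\<^esub> m W" if "V \<in> carrier D.MN" "W \<in> carrier D.MN" for V W
    using hom_mult[OF m(1) that] by simp
  have "\<mu> (?e (?t V)) = m V" if "V \<in> carrier D.MN" for V
    using that
  proof (induction rule: D.tensor_induct)
    case (pure x y)
    then show ?case by (simp add: t_pure e_pure \<mu>(2) m(2))
  next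
    case (add V W)
    then show ?case by (simp add: \<mu>_add m_add)
  qed
  then have \<mu>0: "\<mu> (?e (?t U)) = \<zero>\<^bsub>N\<^esub>" using U by simp
  have unit_tensor: "\<exists>y\<in>carrier N. V = DR.pure (j \<one>\<^bsub>R\<^esub>) y" if "V \<in> carrier DR.MN" for V
    using that
  proof (induction rule: DR.tensor_induct)
    case (pure x y)
    then obtain r where r: "x = j r" "r \<in> carrier R" by auto
    then have "DR.pure x y = DR.pure (j \<one>\<^bsub>R\<^esub>) (r \<odot>\<^bsub>N\<^esub> y)"
      using DR.pure_balanced[of "j \<one>\<^bsub>R\<^esub>" r y] pure by simp
    then show ?case using r pure N.smult_closed by blast
  next
    case (add V W)
    then obtain y z where "y \<in> carrier N" "z \<in> carrier N"
      "V = DR.pure (j \<one>\<^bsub>R\<^esub>) y" "W = DR.pure (j \<one>\<^bsub>R\<^esub>) z" by blast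
    then show ?case
      using DR.pure_add_right[of "j \<one>\<^bsub>R\<^esub>" y z] by (intro bexI[of _ "y \<oplus>\<^bsub>N\<^esub> z"]) simp_all
  qed
  obtain y where y: "y \<in> carrier N" "?e (?t U) = DR.pure (j \<one>\<^bsub>R\<^esub>) y"
    using unit_tensor[OF e.hom_closed[OF t.hom_closed[OF U(1)]]] by blast
  then have "y = \<zero>\<^bsub>N\<^esub>"
    using \<mu>0 \<mu>(2)[of "j \<one>\<^bsub>R\<^esub>" y] by (simp add: N.smult_one)
  then have "?e (?t U) = \<one>\<^bsub>DR.MN\<^esub>"
    using y DR.pure_zero_right[of "j \<one>\<^bsub>R\<^esub>"] by simp
  then have "?t U = \<one>\<^bsub>DI.MN\<^esub>"
    using ker U(1) by simp
  then show ?thesis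
    using st[OF U(1)] s.hom_one by simp
qed


section \<open>Descent of bases along a retraction onto a subring\<close>

text \<open>The setting of both halves of the proof: a right ideal \<open>K\<close> of a subring \<open>C\<close> of \<open>A\<close>.  In
  the application \<open>C\<close> is the component of degree zero.\<close>

locale subring_right_ideal = ring A for A (structure) +
  fixes C K
  assumes C_subring: "subring C A"
    and K_right_ideal: "right_ideal K (A\<lparr>carrier := C\<rparr>)"
begin

abbreviation A\<^sub>C where "A\<^sub>C \<equiv> A\<lparr>carrier := C\<rparr>"

abbreviation KA where "KA \<equiv> K \<cdot> carrier A"

lemma C_carrier [simp]: "c \<in> C \<Longrightarrow> c \<in> carrier A"
  using subringE(1)[OF C_subring] by blast

lemma one_C: "\<one> \<in> C"
  by (rule subringE(3)[OF C_subring])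

lemma ring_AC: "ring A\<^sub>C"
  by (rule subring_is_ring[OF C_subring])

lemma K_subgroup: "additive_subgroup K A"
proof -
  interpret K: right_ideal K A\<^sub>C by (rule K_right_ideal)
  have "subgroup K ((add_monoid A)\<lparr>carrier := C\<rparr>)"
    using K.a_subgroup by simp
  moreover have "subgroup C (add_monoid A)"
    using C_subring by (simp add: subring_def)
  ultimately show ?thesis
    using additive_subgroup.intro[OF add.incl_subgroup] by blast
qed

sublocale K: additive_subgroup K A
  by (rule K_subgroup)

lemma K_C: "k \<in> K \<Longrightarrow> k \<in> C"
  using additive_subgroup.a_subset[OF right_ideal.axioms(1)[OF K_right_ideal]] by auto

lemma K_carrier [simp]: "k \<in> K \<Longrightarrow> k \<in> carrier A"
  using K.a_Hcarr .

lemma K_mult: "k \<in> K \<Longrightarrow> c \<in> C \<Longrightarrow> k \<otimes> c \<in> K"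
  using right_ideal.I_r_closed[OF K_right_ideal] by simp

lemma right_module_K: "right_module A\<^sub>C (rideal_rmodule A\<^sub>C K)"
  by (rule right_ideal.right_module_rideal[OF K_right_ideal])

lemma finsum_K: "f \<in> T \<rightarrow> K \<Longrightarrow> finsum (rideal_rmodule A\<^sub>C K) f T = finsum A f T"
proof (rule finsum_subrecord)
  interpret right_module A\<^sub>C "rideal_rmodule A\<^sub>C K" by (rule right_module_K)
  show "abelian_monoid (rideal_rmodule A\<^sub>C K)" by unfold_locales
qed (auto simp: abelian_monoid_axioms)

lemma KA_carrier [simp]: "x \<in> KA \<Longrightarrow> x \<in> carrier A"
  by (induction rule: ideal_prod.induct) auto

lemma K_KA: "k \<in> K \<Longrightarrow> k \<in> KA"
  using ideal_prod.prod[of k K \<one> "carrier A" A] by simp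

lemma KA_right_ideal: "right_ideal KA A"
proof (intro right_ideal.intro right_ideal_axioms.intro ring_axioms additive_subgroup.intro add.subgroupI)
  show "KA \<noteq> {}" using K_KA K.zero_closed by blast
  show "\<ominus> x \<in> KA" if "x \<in> KA" for x
    using that
  proof induction
    case (prod k a)
    then have "k \<otimes> (\<ominus> a) \<in> KA" by (intro ideal_prod.prod) auto
    then show ?case using prod by (simp add: r_minus)
  next
    case (sum x y)
    then show ?case by (simp add: minus_add ideal_prod.sum)
  qed
  show "x \<otimes> a \<in> KA" if "x \<in> KA" "a \<in> carrier A" for x a
    using that
  proof (induction rule: ideal_prod.induct)
    case (prod k b)
    then show ?case by (simp add: m_assoc ideal_prod.prod)
  next
    case (sum x y)
    then show ?case by (simp add: l_distr ideal_prod.sum)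
  qed
qed (auto intro: ideal_prod.sum)

sublocale KA: right_ideal KA A
  by (rule KA_right_ideal)

text \<open>Freeness of \<open>KA\<close> descends to \<open>K\<close> if \<open>C\<close> is a retract of \<open>A\<close>, that is, if \<open>A = C \<oplus> J\<close> for a two-sided
  ideal \<open>J\<close>.  The projection \<open>p\<close> onto \<open>C\<close> is then multiplicative and maps \<open>KA\<close> onto \<open>K\<close>.  An element \<open>x\<close> of \<open>KA\<close>
  differs from \<open>p(x)\<close> by a combination of basis elements with coefficients in \<open>J\<close>, since this holds for
  \<open>k a - p(k a) = k (a - p(a))\<close>.  So a combination of basis elements lies in \<open>J\<close> only if all its
  coefficients do, which says that the images of the basis elements are independent over \<open>C\<close>.\<close>

lemma free_descends:
  assumes J: "ideal J A" and split: "\<And>a. a \<in> carrier A \<Longrightarrow> \<exists>c\<in>C. a \<ominus> c \<in> J"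
    and CJ: "C \<inter> J = {\<zero>}" and one: "\<one> \<noteq> \<zero>"
    and basis: "rmod_basis A (rideal_rmodule A KA) B"
  shows "\<exists>B'. rmod_basis A\<^sub>C (rideal_rmodule A\<^sub>C K) B'"
proof -
  interpret J: ideal J A by (rule J)
  interpret MA: right_module A "rideal_rmodule A KA" by (rule KA.right_module_rideal)
  interpret MK: right_module A\<^sub>C "rideal_rmodule A\<^sub>C K" by (rule right_module_K)
  note C_minus = subringE(5)[OF C_subring] and C_add = subringE(7)[OF C_subring]
    and C_mult = subringE(6)[OF C_subring]
  have B: "B \<subseteq> KA" using basis by (simp add: rmod_basis_def)
  obtain p where p: "\<And>a. a \<in> carrier A \<Longrightarrow> p a \<in> C" "\<And>a. a \<in> carrier A \<Longrightarrow> a \<ominus> p a \<in> J"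
    using split by metis
  have p_carrier [simp]: "a \<in> carrier A \<Longrightarrow> p a \<in> carrier A" for a
    using p(1) C_carrier by blast
  have p_eq: "p a = c" if "a \<in> carrier A" "c \<in> C" "a \<ominus> c \<in> J" for a c
  proof -
    have "(a \<ominus> c) \<ominus> (a \<ominus> p a) \<in> J"
      using p(2)[OF that(1)] that(3) by (simp add: a_minus_def J.a_closed)
    also have "(a \<ominus> c) \<ominus> (a \<ominus> p a) = p a \<ominus> c"
      using that by (simp add: a_minus_def minus_add a_ac r_neg1 r_neg2)
    finally have "p a \<ominus> c \<in> C \<inter> J"
      using p(1)[OF that(1)] that by (simp add: a_minus_def C_add C_minus)
    then show ?thesis using that CJ by simp
  qed
  have p_add: "p (a \<oplus> b) = p a \<oplus> p b" if "a \<in> carrier A" "b \<in> carrier A" for a b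
  proof (rule p_eq)
    have "(a \<ominus> p a) \<oplus> (b \<ominus> p b) \<in> J" using p(2) that by (simp add: J.a_closed)
    also have "(a \<ominus> p a) \<oplus> (b \<ominus> p b) = a \<oplus> b \<ominus> (p a \<oplus> p b)"
      using that by (simp add: a_minus_def minus_add a_ac)
    finally show "a \<oplus> b \<ominus> (p a \<oplus> p b) \<in> J" .
  qed (use that in \<open>auto intro: C_add p(1)\<close>)
  have p_mult: "p (a \<otimes> b) = p a \<otimes> p b" if "a \<in> carrier A" "b \<in> carrier A" for a b
  proof (rule p_eq)
    have "(a \<ominus> p a) \<otimes> b \<oplus> p a \<otimes> (b \<ominus> p b) \<in> J"
      using p(2) that by (simp add: J.a_closed J.I_l_closed J.I_r_closed)
    also have "(a \<ominus> p a) \<otimes> b \<oplus> p a \<otimes> (b \<ominus> p b) = a \<otimes> b \<ominus> p a \<otimes> p b"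
      using that by (simp add: a_minus_def l_distr r_distr l_minus r_minus a_ac r_neg1 r_neg2)
    finally show "a \<otimes> b \<ominus> p a \<otimes> p b \<in> J" .
  qed (use that in \<open>auto intro: C_mult p(1)\<close>)
  have p_C: "p c = c" if "c \<in> C" for c
    using that by (intro p_eq) (simp_all add: a_minus_def r_neg)
  have p_J: "p a = \<zero> \<longleftrightarrow> a \<in> J" if "a \<in> carrier A" for a
  proof -
    have "a \<ominus> \<zero> = a" "\<zero> \<in> C" using that CJ by (auto simp: a_minus_def)
    then show ?thesis using that p(2)[of a] p_eq[of a \<zero>] by metis
  qed
  have p_sum: "p (\<Oplus>i\<in>T. f i) = (\<Oplus>i\<in>T. p (f i))" if "f \<in> T \<rightarrow> carrier A" for f and T :: "'c set"
    using that
  proof (induction T rule: infinite_finite_induct)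
    case (insert i T)
    then show ?case by (simp add: Pi_iff p_add finsum_closed)
  qed (use CJ in \<open>simp_all add: p_J\<close>)
  have p_KA: "p x \<in> K" if "x \<in> KA" for x
    using that
  proof induction
    case (prod k a)
    then show ?case by (simp add: p_mult p_C K_C K_mult p(1))
  next
    case (sum x y)
    then show ?case by (simp add: p_add)
  qed

  have span: "\<exists>T c. finite T \<and> T \<subseteq> B \<and> (\<forall>b\<in>T. c b \<in> carrier A) \<and> x = (\<Oplus>b\<in>T. b \<otimes> c b)" if x: "x \<in> KA" for x
  proof -
    obtain T c where T: "finite T" "T \<subseteq> B" "\<forall>b\<in>T. c b \<in> carrier A"
      "x = (\<Oplus>\<^bsub>rideal_rmodule A KA\<^esub>b\<in>T. b \<otimes> c b)"
      using basis x unfolding MA.rmod_basis_iff by auto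
    moreover have "(\<Oplus>\<^bsub>rideal_rmodule A KA\<^esub>b\<in>T. b \<otimes> c b) = (\<Oplus>b\<in>T. b \<otimes> c b)"
      using T B by (intro KA.finsum_rideal) (auto intro: KA.I_r_closed)
    ultimately show ?thesis by metis
  qed

  \<comment> \<open>The set \<open>W\<close> is \<open>(KA)J\<close>, described through the basis.\<close>
  define W where "W = {y. \<exists>T d. finite T \<and> T \<subseteq> B \<and> (\<forall>b\<in>T. d b \<in> J) \<and> y = (\<Oplus>b\<in>T. b \<otimes> d b)}"
  have W_add: "x \<oplus> y \<in> W" if xW: "x \<in> W" and yW: "y \<in> W" for x y
  proof -
    obtain S c where S: "finite S" "S \<subseteq> B" "\<forall>b\<in>S. c b \<in> J" "x = (\<Oplus>b\<in>S. b \<otimes> c b)"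
      using xW unfolding W_def by blast
    obtain T d where T: "finite T" "T \<subseteq> B" "\<forall>b\<in>T. d b \<in> J" "y = (\<Oplus>b\<in>T. b \<otimes> d b)"
      using yW unfolding W_def by blast
    define c' where "c' = (\<lambda>b. if b \<in> S then c b else \<zero>)"
    define d' where "d' = (\<lambda>b. if b \<in> T then d b else \<zero>)"
    have c'd': "c' b \<in> J" "d' b \<in> J" for b
      using S T by (auto simp: c'_def d'_def)
    have B': "b \<in> carrier A" if "b \<in> B" for b using B KA_carrier that by blast
    have "x = (\<Oplus>b\<in>S \<union> T. b \<otimes> c' b)" unfolding S(4)
      using S T B' by (intro add.finprod_mono_neutral_cong_left) (auto simp: c'_def)
    moreover have "y = (\<Oplus>b\<in>S \<union> T. b \<otimes> d' b)" unfolding T(4)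
      using S T B' by (intro add.finprod_mono_neutral_cong_left) (auto simp: d'_def)
    ultimately have "x \<oplus> y = (\<Oplus>b\<in>S \<union> T. b \<otimes> c' b \<oplus> b \<otimes> d' b)"
      using S T B' c'd' by (subst finsum_addf) auto
    also have "\<dots> = (\<Oplus>b\<in>S \<union> T. b \<otimes> (c' b \<oplus> d' b))"
      using S T B' c'd' by (intro finsum_cong') (auto simp: r_distr)
    finally show ?thesis
      unfolding W_def using S T c'd' J.a_closed by (intro CollectI exI[of _ "S \<union> T"] exI[of _ "\<lambda>b. c' b \<oplus> d' b"]) auto
  qed
  have W_KAJ: "k \<otimes> j \<in> W" if "k \<in> K" "j \<in> J" for k j
  proof -
    obtain T c where T: "finite T" "T \<subseteq> B" "\<forall>b\<in>T. c b \<in> carrier A" "k = (\<Oplus>b\<in>T. b \<otimes> c b)"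
      using span[OF K_KA[OF \<open>k \<in> K\<close>]] by blast
    have B': "b \<in> carrier A" if "b \<in> T" for b using B T KA_carrier that by blast
    have "k \<otimes> j = (\<Oplus>b\<in>T. (b \<otimes> c b) \<otimes> j)"
      unfolding T(4) using T B' \<open>j \<in> J\<close> by (intro finsum_ldistr) auto
    also have "\<dots> = (\<Oplus>b\<in>T. b \<otimes> (c b \<otimes> j))"
      using T B' \<open>j \<in> J\<close> by (intro finsum_cong') (auto simp: m_assoc)
    finally show ?thesis
      unfolding W_def using T \<open>j \<in> J\<close> J.I_l_closed by (intro CollectI exI[of _ T] exI[of _ "\<lambda>b. c b \<otimes> j"]) auto
  qed
  have W: "x \<ominus> p x \<in> W" if "x \<in> KA" for x
    using that
  proof induction
    case (prod k a)
    then have "k \<otimes> a \<ominus> p (k \<otimes> a) = k \<otimes> (a \<ominus> p a)"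
      by (simp add: p_mult p_C K_C a_minus_def r_distr r_minus)
    then show ?case using prod p(2) W_KAJ by simp
  next
    case (sum x y)
    then have "x \<oplus> y \<ominus> p (x \<oplus> y) = (x \<ominus> p x) \<oplus> (y \<ominus> p y)"
      by (simp add: p_add a_minus_def minus_add a_ac)
    then show ?case using sum W_add by simp
  qed

  \<comment> \<open>The basis stays independent modulo \<open>J\<close>.\<close>
  have indep: "\<forall>b\<in>T. c b \<in> J"
    if T: "finite T" "T \<subseteq> B" "\<And>b. b \<in> T \<Longrightarrow> c b \<in> carrier A" and in_J: "(\<Oplus>b\<in>T. b \<otimes> c b) \<in> J" for T c
  proof
    fix b assume b: "b \<in> T"
    have inKA: "(\<lambda>b. b \<otimes> e b) \<in> S \<rightarrow> KA" if "S \<subseteq> B" "\<And>b. b \<in> S \<Longrightarrow> e b \<in> carrier A" for S e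
      using that B by (auto intro!: KA.I_r_closed)
    then have sumK: "(\<Oplus>b\<in>S. b \<otimes> e b) = (\<Oplus>\<^bsub>rideal_rmodule A KA\<^esub>b\<in>S. b \<otimes> e b)"
      if "S \<subseteq> B" "\<And>b. b \<in> S \<Longrightarrow> e b \<in> carrier A" for S e
      using that by (intro KA.finsum_rideal[symmetric]) blast
    have "(\<Oplus>b\<in>T. b \<otimes> c b) \<in> KA"
      using MA.finsum_closed[of "\<lambda>b. b \<otimes> c b" T] inKA[OF T(2,3)] sumK[OF T(2,3)] by simp
    moreover from this in_J have "p (\<Oplus>b\<in>T. b \<otimes> c b) = \<zero>"
      using p_J KA_carrier by blast
    ultimately have "(\<Oplus>b\<in>T. b \<otimes> c b) \<in> W"
      using W[of "\<Oplus>b\<in>T. b \<otimes> c b"] by (simp add: a_minus_def)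
    then obtain S d where S: "finite S" "S \<subseteq> B" "\<forall>b\<in>S. d b \<in> J" "(\<Oplus>b\<in>T. b \<otimes> c b) = (\<Oplus>b\<in>S. b \<otimes> d b)"
      unfolding W_def by blast
    have "c b = (if b \<in> S then d b else \<zero>)"
      using T S b sumK[of T c] sumK[of S d]
      by (intro MA.basis_coeffs_unique[OF basis, of T c S d b]) auto
    then show "c b \<in> J" using S by auto
  qed

  \<comment> \<open>If \<open>p b = p b'\<close>, then the difference \<open>b - b'\<close> lies in \<open>J\<close>, although its coefficients 1 and -1 do not.\<close>
  have inj: "inj_on p B"
  proof (rule inj_onI, rule ccontr)
    fix b b' assume b: "b \<in> B" "b' \<in> B" "p b = p b'" "b \<noteq> b'"
    have bA: "b \<in> carrier A" "b' \<in> carrier A" using b B KA_carrier by blast+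
    let ?c = "\<lambda>x. if x = b then \<one> else \<ominus> \<one>"
    have diff: "(\<Oplus>x\<in>{b, b'}. x \<otimes> ?c x) = b \<ominus> b'"
      using b bA by (simp add: a_minus_def r_minus)
    have "p (\<ominus> b') \<oplus> p b' = p (\<ominus> b' \<oplus> b')"
      using bA by (simp only: p_add a_inv_closed)
    also have "\<dots> = \<zero>"
      using bA p_C[OF subringE(2)[OF C_subring]] by (simp only: l_neg)
    finally have pm: "p (\<ominus> b') = \<ominus> p b'"
      using bA minus_equality by simp
    have "p (b \<ominus> b') = \<zero>"
      using bA b by (simp add: a_minus_def p_add pm r_neg)
    then have "(\<Oplus>x\<in>{b, b'}. x \<otimes> ?c x) \<in> J"
      unfolding diff using bA p_J by simp
    then have "\<forall>x\<in>{b,b'}. ?c x \<in> J"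
      using b by (intro indep) auto
    then have "\<one> \<in> C \<inter> J" using one_C by simp
    then show False using CJ one by simp
  qed

  have "rmod_basis A\<^sub>C (rideal_rmodule A\<^sub>C K) (p ` B)"
    unfolding MK.rmod_basis_iff
  proof (intro conjI ballI allI impI)
    show "p ` B \<subseteq> carrier (rideal_rmodule A\<^sub>C K)"
      using p_KA B by auto
  next
    fix x assume "x \<in> carrier (rideal_rmodule A\<^sub>C K)"
    then have x: "x \<in> K" by simp
    obtain T c where T: "finite T" "T \<subseteq> B" "\<forall>b\<in>T. c b \<in> carrier A" "x = (\<Oplus>b\<in>T. b \<otimes> c b)"
      using span[OF K_KA[OF x]] by blast
    have B': "b \<in> carrier A" "b \<in> KA" if "b \<in> T" for b using B T KA_carrier that by blast+
    have injT: "inj_on p T" using inj T inj_on_subset by blast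
    define c' where "c' = (\<lambda>y. p (c (inv_into T p y)))"
    have c': "c' (p b) = p (c b)" if "b \<in> T" for b
      using that injT by (simp add: c'_def)
    have "x = (\<Oplus>b\<in>T. p (b \<otimes> c b))"
      using p_C[OF K_C[OF x]] p_sum[of "\<lambda>b. b \<otimes> c b" T] T B' by simp
    also have "\<dots> = (\<Oplus>b\<in>T. p b \<otimes> c' (p b))"
      using T B' by (intro finsum_cong') (auto simp: p_mult c')
    also have "\<dots> = (\<Oplus>y\<in>p ` T. y \<otimes> c' y)"
      using T B' injT c' by (intro finsum_reindex[symmetric]) auto
    also have "\<dots> = (\<Oplus>\<^bsub>rideal_rmodule A\<^sub>C K\<^esub>y\<in>p ` T. y \<otimes> c' y)"
      using T B' c' p_KA p(1) by (intro finsum_K[symmetric]) (auto intro: K_mult)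
    finally show "\<exists>T c. finite T \<and> T \<subseteq> p ` B \<and> (\<forall>b\<in>T. c b \<in> carrier A\<^sub>C) \<and>
        x = (\<Oplus>\<^bsub>rideal_rmodule A\<^sub>C K\<^esub>b\<in>T. b \<star>\<^bsub>rideal_rmodule A\<^sub>C K\<^esub> c b)"
      using T c' p(1) by (intro exI[of _ "p ` T"] exI[of _ c']) auto
  next
    fix S c y
    assume "finite S \<and> S \<subseteq> p ` B \<and> (\<forall>b\<in>S. c b \<in> carrier A\<^sub>C) \<and>
      (\<Oplus>\<^bsub>rideal_rmodule A\<^sub>C K\<^esub>b\<in>S. b \<star>\<^bsub>rideal_rmodule A\<^sub>C K\<^esub> c b) = \<zero>\<^bsub>rideal_rmodule A\<^sub>C K\<^esub>" and y: "y \<in> S"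
    then have S: "finite S" "S \<subseteq> p ` B" "\<forall>b\<in>S. c b \<in> C"
      and S0: "(\<Oplus>\<^bsub>rideal_rmodule A\<^sub>C K\<^esub>b\<in>S. b \<otimes> c b) = \<zero>" by auto
    obtain T where T: "T \<subseteq> B" "S = p ` T" using S(2) subset_image_iff by metis
    have injT: "inj_on p T" using inj T inj_on_subset by blast
    have finT: "finite T" using S T injT finite_imageD by blast
    have B': "b \<in> carrier A" "b \<in> KA" if "b \<in> T" for b using B T KA_carrier that by blast+
    have cC: "c (p b) \<in> C" if "b \<in> T" for b using S T that by auto
    have "(\<Oplus>b\<in>S. b \<otimes> c b) = \<zero>"
      unfolding S0[symmetric] using T B' cC p_KA by (intro finsum_K[symmetric]) (auto intro!: K_mult)
    also have "(\<Oplus>b\<in>S. b \<otimes> c b) = (\<Oplus>b\<in>T. p b \<otimes> c (p b))"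
      unfolding T using B' cC injT by (intro finsum_reindex) auto
    also have "\<dots> = (\<Oplus>b\<in>T. p (b \<otimes> c (p b)))"
      using B' cC by (intro finsum_cong') (auto simp: p_mult p_C)
    also have "\<dots> = p (\<Oplus>b\<in>T. b \<otimes> c (p b))"
      using B' cC by (intro p_sum[symmetric]) auto
    finally have "(\<Oplus>b\<in>T. b \<otimes> c (p b)) \<in> J"
      using B' cC p_J by (simp add: finsum_closed)
    then have "\<forall>b\<in>T. c (p b) \<in> J"
      using finT T B' cC by (intro indep) auto
    then show "c y = \<zero>\<^bsub>A\<^sub>C\<^esub>"
      using y T cC CJ by auto
  qed
  then show ?thesis by blast
qed

end


section \<open>Extension of scalars and stable freeness\<close>

context subring_right_ideal
begin

lemma left_module_A: "left_module A\<^sub>C (ring_lmodule A)"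
proof -
  have "abelian_group (ring_lmodule A)"
  proof (rule abelian_groupI)
    fix x assume "x \<in> carrier (ring_lmodule A)"
    then show "\<exists>y\<in>carrier (ring_lmodule A). y \<oplus>\<^bsub>ring_lmodule A\<^esub> x = \<zero>\<^bsub>ring_lmodule A\<^esub>"
      by (intro bexI[of _ "\<ominus> x"]) (simp_all add: l_neg)
  qed (simp_all add: a_ac)
  then show ?thesis
    by (intro left_module.intro left_module_axioms.intro ring_AC)
      (simp_all add: l_distr r_distr m_assoc)
qed

sublocale KtA: tensor_product A\<^sub>C "rideal_rmodule A\<^sub>C K" "ring_lmodule A"
  by (intro tensor_product.intro right_module_K left_module_A)

abbreviation K_tensor_A where
  "K_tensor_A \<equiv> tensor_rmodule A\<^sub>C (rideal_rmodule A\<^sub>C K) (ring_lmodule A) (rideal_rmodule A (carrier A))"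

lemma K_tensor_A_smult:
  assumes "a \<in> carrier A"
  shows "(\<lambda>U. U \<star>\<^bsub>K_tensor_A\<^esub> a) \<in> hom KtA.MN KtA.MN"
    and "\<And>k b. \<lbrakk>k \<in> K; b \<in> carrier A\<rbrakk> \<Longrightarrow> KtA.pure k b \<star>\<^bsub>K_tensor_A\<^esub> a = KtA.pure k (b \<otimes> a)"
proof -
  have eq: "(\<lambda>U. U \<star>\<^bsub>K_tensor_A\<^esub> a)
      = tensor_map A\<^sub>C (rideal_rmodule A\<^sub>C K) (ring_lmodule A) (\<lambda>x. x) (\<lambda>y. y \<otimes> a)"
    by (simp add: tensor_rmodule_def)
  show "(\<lambda>U. U \<star>\<^bsub>K_tensor_A\<^esub> a) \<in> hom KtA.MN KtA.MN"
    unfolding eq using assms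
    by (intro tensor_map_hom(1) KtA.tensor_product_axioms) (simp_all add: l_distr m_assoc)
  have "tensor_map A\<^sub>C (rideal_rmodule A\<^sub>C K) (ring_lmodule A) (\<lambda>x. x) (\<lambda>y. y \<otimes> a) (KtA.pure k b)
      = KtA.pure k (b \<otimes> a)" if "k \<in> K" "b \<in> carrier A" for k b
    using assms that
    by (intro tensor_map_hom(2) KtA.tensor_product_axioms) (simp_all add: l_distr m_assoc)
  then show "\<And>k b. \<lbrakk>k \<in> K; b \<in> carrier A\<rbrakk> \<Longrightarrow> KtA.pure k b \<star>\<^bsub>K_tensor_A\<^esub> a = KtA.pure k (b \<otimes> a)"
    using eq by metis
qed

text \<open>The image of the multiplication map is \<open>KA\<close> by definition, and its kernel is trivial by flatness.\<close>

lemma K_tensor_A_iso_KA: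
  fixes j :: "'a \<Rightarrow> 'u"
  assumes flat: "faithfully_flat TYPE('u) A\<^sub>C (ring_lmodule A)" and j: "inj j"
  obtains h where "h \<in> rmod_iso A K_tensor_A (rideal_rmodule A KA)"
    "\<And>k a. \<lbrakk>k \<in> K; a \<in> carrier A\<rbrakk> \<Longrightarrow> h (KtA.pure k a) = k \<otimes> a"
proof -
  have AG: "comm_group (add_monoid A)" by (rule a_comm_group)
  obtain h where h: "h \<in> hom KtA.MN (add_monoid A)"
    "\<And>k a. \<lbrakk>k \<in> K; a \<in> carrier A\<rbrakk> \<Longrightarrow> h (KtA.pure k a) = k \<otimes> a"
    by (rule KtA.tensor_lift[OF AG, of "\<lambda>k a. k \<otimes> a"]) (simp_all add: l_distr r_distr m_assoc)
  interpret h: group_hom KtA.MN "add_monoid A" h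
    using h(1) by unfold_locales
  have h_add: "h (U \<otimes>\<^bsub>KtA.MN\<^esub> V) = h U \<oplus> h V" if "U \<in> carrier KtA.MN" "V \<in> carrier KtA.MN" for U V
    using h.hom_mult[OF that] by simp
  have h_KA: "h U \<in> KA" if "U \<in> carrier KtA.MN" for U
    using that
  proof (induction rule: KtA.tensor_induct)
    case (pure k a)
    then show ?case by (simp add: h(2) ideal_prod.prod)
  next
    case (add U V)
    then show ?case by (simp add: h_add ideal_prod.sum)
  qed
  have surj: "\<exists>U\<in>carrier KtA.MN. x = h U" if "x \<in> KA" for x
    using that
  proof induction
    case (prod k a)
    then show ?case by (intro bexI[of _ "KtA.pure k a"]) (simp_all add: h(2))
  next
    case (sum x y)
    then obtain U V where "U \<in> carrier KtA.MN" "V \<in> carrier KtA.MN" "x = h U" "y = h V" by blast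
    then show ?case by (intro bexI[of _ "U \<otimes>\<^bsub>KtA.MN\<^esub> V"]) (simp_all add: h_add)
  qed
  have "kernel KtA.MN (add_monoid A) h \<subseteq> {\<one>\<^bsub>KtA.MN\<^esub>}"
  proof
    fix U assume "U \<in> kernel KtA.MN (add_monoid A) h"
    then have U: "U \<in> carrier KtA.MN" "h U = \<zero>" by (auto simp: kernel_def)
    have "U = \<one>\<^bsub>KtA.MN\<^esub>"
    proof (rule flat_mult_injective[OF flat j K_right_ideal, of h])
      show "h \<in> hom KtA.MN (add_monoid (ring_lmodule A))"
        using h(1) by (simp add: hom_def)
    qed (use U h(2) in simp_all)
    then show "U \<in> {\<one>\<^bsub>KtA.MN\<^esub>}" by simp
  qed
  moreover have "\<one>\<^bsub>KtA.MN\<^esub> \<in> kernel KtA.MN (add_monoid A) h"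
    using h.hom_one by (simp add: kernel_def)
  ultimately have "inj_on h (carrier KtA.MN)"
    using h.inj_iff_trivial_ker by blast
  moreover have "h ` carrier KtA.MN = KA"
    using h_KA surj by blast
  ultimately have bij: "bij_betw h (carrier KtA.MN) KA"
    by (simp add: bij_betw_def)
  have h_smult: "h (U \<star>\<^bsub>K_tensor_A\<^esub> a) = h U \<otimes> a" if a: "a \<in> carrier A" and "U \<in> carrier KtA.MN" for U a
    using that(2)
  proof (induction rule: KtA.tensor_induct)
    case (pure k b)
    then show ?case using a by (simp add: K_tensor_A_smult(2) h(2) m_assoc)
  next
    case (add U V)
    have "U \<star>\<^bsub>K_tensor_A\<^esub> a \<in> carrier KtA.MN" "V \<star>\<^bsub>K_tensor_A\<^esub> a \<in> carrier KtA.MN"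
      using hom_in_carrier[OF K_tensor_A_smult(1)[OF a]] add by blast+
    then show ?case
      using hom_mult[OF K_tensor_A_smult(1)[OF a] add(1,2)] add h_KA a
      by (simp add: h_add l_distr)
  qed
  have car: "carrier K_tensor_A = carrier KtA.MN" "add K_tensor_A = monoid.mult KtA.MN"
    by (simp_all add: tensor_rmodule_def)
  have "h \<in> rmod_hom A K_tensor_A (rideal_rmodule A KA)"
    by (rule rmod_homI) (simp_all add: car h_KA h_add h_smult)
  then have "h \<in> rmod_iso A K_tensor_A (rideal_rmodule A KA)"
    using bij by (simp add: rmod_iso_def car)
  then show thesis using h(2) that by blast
qed

text \<open>The element \<open>\<Sum> k\<^sub>i a\<^sub>i\<close> has to go to \<open>\<Sum> f(k\<^sub>i) a\<^sub>i\<close>.  This does not depend on the representation because the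
  tensor \<open>\<Sum> k\<^sub>i \<otimes> a\<^sub>i\<close> is determined by the element, which is where flatness enters.\<close>

lemma extend_hom_KA:
  fixes j :: "'a \<Rightarrow> 'u" and P :: "('a, 'm, 'z) rmodule_scheme"
  assumes flat: "faithfully_flat TYPE('u) A\<^sub>C (ring_lmodule A)" and j: "inj j"
    and P: "right_module A P" and f: "f \<in> rmod_hom A\<^sub>C (rideal_rmodule A\<^sub>C K) P"
  obtains g where "g \<in> rmod_hom A (rideal_rmodule A KA) P" "\<And>k. k \<in> K \<Longrightarrow> g k = f k"
proof -
  interpret P: right_module A P by (rule P)
  obtain h where h: "h \<in> rmod_iso A K_tensor_A (rideal_rmodule A KA)"
    "\<And>k a. \<lbrakk>k \<in> K; a \<in> carrier A\<rbrakk> \<Longrightarrow> h (KtA.pure k a) = k \<otimes> a"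
    using K_tensor_A_iso_KA[OF flat j] by blast
  have f': "\<And>k. k \<in> K \<Longrightarrow> f k \<in> carrier P"
    "\<And>k l. \<lbrakk>k \<in> K; l \<in> K\<rbrakk> \<Longrightarrow> f (k \<oplus> l) = f k \<oplus>\<^bsub>P\<^esub> f l"
    "\<And>k c. \<lbrakk>k \<in> K; c \<in> C\<rbrakk> \<Longrightarrow> f (k \<otimes> c) = f k \<star>\<^bsub>P\<^esub> c"
    using rmod_homD[OF f] by simp_all
  have PG: "comm_group (add_monoid P)" by (rule P.M.a_comm_group)
  obtain e where e: "e \<in> hom KtA.MN (add_monoid P)"
    "\<And>k a. \<lbrakk>k \<in> K; a \<in> carrier A\<rbrakk> \<Longrightarrow> e (KtA.pure k a) = f k \<star>\<^bsub>P\<^esub> a"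
    by (rule KtA.tensor_lift[OF PG, of "\<lambda>k a. f k \<star>\<^bsub>P\<^esub> a"])
      (simp_all add: f' P.rsmult_closed P.rsmult_l_distr P.rsmult_r_distr P.rsmult_assoc)
  have bij: "bij_betw h (carrier KtA.MN) KA"
    and h_add: "\<And>U V. \<lbrakk>U \<in> carrier KtA.MN; V \<in> carrier KtA.MN\<rbrakk> \<Longrightarrow> h (U \<otimes>\<^bsub>KtA.MN\<^esub> V) = h U \<oplus> h V"
    using h(1) by (auto simp: rmod_iso_def rmod_hom_def tensor_rmodule_def)
  define g where "g = (\<lambda>x. e (inv_into (carrier KtA.MN) h x))"
  have gh: "g (h U) = e U" if "U \<in> carrier KtA.MN" for U
    using bij that by (simp add: g_def bij_betw_inv_into_left)
  have hs: "\<exists>U\<in>carrier KtA.MN. x = h U" if "x \<in> KA" for x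
    using bij that by (auto simp: bij_betw_def)
  have g_carrier: "g x \<in> carrier P" if "x \<in> KA" for x
    using hs[OF that] gh hom_in_carrier[OF e(1)] by auto
  have g_add: "g (x \<oplus> y) = g x \<oplus>\<^bsub>P\<^esub> g y" if xy: "x \<in> KA" "y \<in> KA" for x y
  proof -
    obtain U V where UV: "U \<in> carrier KtA.MN" "V \<in> carrier KtA.MN" "x = h U" "y = h V"
      using hs xy by metis
    then show ?thesis
      using gh[of "U \<otimes>\<^bsub>KtA.MN\<^esub> V"] hom_mult[OF e(1) UV(1,2)] by (simp add: gh h_add)
  qed
  have g_prod: "g (k \<otimes> a) = f k \<star>\<^bsub>P\<^esub> a" if "k \<in> K" "a \<in> carrier A" for k a
    using gh[of "KtA.pure k a"] that by (simp add: h(2) e(2))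
  have g_smult: "g (x \<otimes> a) = g x \<star>\<^bsub>P\<^esub> a" if "x \<in> KA" and a: "a \<in> carrier A" for x a
    using that(1)
  proof induction
    case (prod k b)
    then show ?case
      using a g_prod[of k "b \<otimes> a"] by (simp add: m_assoc g_prod P.rsmult_assoc f')
  next
    case (sum x y)
    then show ?case
      using a KA.I_r_closed by (simp add: l_distr g_add P.rsmult_l_distr g_carrier)
  qed
  have "g \<in> rmod_hom A (rideal_rmodule A KA) P"
    by (rule rmod_homI) (simp_all add: g_carrier g_add g_smult)
  moreover have "g k = f k" if "k \<in> K" for k
    using g_prod[of k \<one>] that by (simp add: P.rsmult_one f')
  ultimately show thesis using that by blast
qed

lemma rpower_AC: "v \<in> carrier (rpower A\<^sub>C n) \<Longrightarrow> v \<in> carrier (rpower A n)"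
  by (auto simp: PiE_iff)

lemma unit_vector_AC: "unit_vector A\<^sub>C n i = unit_vector A n i"
  by (simp add: unit_vector_def cong: if_cong)

text \<open>The extension applies the columns \<open>f(e\<^sub>i)\<close> of the matrix of \<open>f\<close> to coordinates in \<open>A\<close>.\<close>

lemma extend_hom_rpower:
  fixes P :: "('a, 'm, 'z) rmodule_scheme"
  assumes P: "right_module A P" and f: "f \<in> rmod_hom A\<^sub>C (rpower A\<^sub>C n) P"
  obtains g where "g \<in> rmod_hom A (rpower A n) P" "\<And>v. v \<in> carrier (rpower A\<^sub>C n) \<Longrightarrow> g v = f v"
proof -
  interpret P: right_module A P by (rule P)
  interpret L: right_module A\<^sub>C "rpower A\<^sub>C n" by (rule ring.right_module_rpower[OF ring_AC])
  interpret LA: right_module A "rpower A n" by (rule right_module_rpower)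
  define e where "e = unit_vector A n"
  have eC: "e i \<in> carrier (rpower A\<^sub>C n)" for i
    unfolding e_def unit_vector_AC[symmetric] by (rule ring.unit_vector_carrier[OF ring_AC])
  have fe: "f (e i) \<in> carrier P" for i
    using rmod_homD(1)[OF f eC] .
  define g where "g = (\<lambda>v. \<Oplus>\<^bsub>P\<^esub>i\<in>{..<n}. f (e i) \<star>\<^bsub>P\<^esub> v i)"
  have g_carrier: "g v \<in> carrier P" if "v \<in> carrier (rpower A n)" for v
    unfolding g_def using rpower_nth[OF that] fe
    by (intro P.M.finsum_closed) (simp add: P.rsmult_closed)
  have g_add: "g (v \<oplus>\<^bsub>rpower A n\<^esub> w) = g v \<oplus>\<^bsub>P\<^esub> g w"
    if vw: "v \<in> carrier (rpower A n)" "w \<in> carrier (rpower A n)" for v w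
  proof -
    note v = rpower_nth[OF vw(1)] and w = rpower_nth[OF vw(2)]
    have "g (v \<oplus>\<^bsub>rpower A n\<^esub> w) = (\<Oplus>\<^bsub>P\<^esub>i\<in>{..<n}. f (e i) \<star>\<^bsub>P\<^esub> v i \<oplus>\<^bsub>P\<^esub> f (e i) \<star>\<^bsub>P\<^esub> w i)"
      unfolding g_def using v w fe
      by (intro P.M.finsum_cong') (simp_all add: P.rsmult_closed P.rsmult_r_distr)
    also have "\<dots> = g v \<oplus>\<^bsub>P\<^esub> g w"
      unfolding g_def using v w fe by (intro P.M.finsum_addf) (simp_all add: P.rsmult_closed)
    finally show ?thesis .
  qed
  have g_smult: "g (v \<star>\<^bsub>rpower A n\<^esub> a) = g v \<star>\<^bsub>P\<^esub> a"
    if vw: "v \<in> carrier (rpower A n)" and a: "a \<in> carrier A" for v a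
  proof -
    note v = rpower_nth[OF vw(1)]
    have "g v \<star>\<^bsub>P\<^esub> a = (\<Oplus>\<^bsub>P\<^esub>i\<in>{..<n}. f (e i) \<star>\<^bsub>P\<^esub> v i \<star>\<^bsub>P\<^esub> a)"
      unfolding g_def using v fe a by (intro P.finsum_rsmult) (simp_all add: P.rsmult_closed)
    also have "\<dots> = g (v \<star>\<^bsub>rpower A n\<^esub> a)"
      unfolding g_def using v fe a
      by (intro P.M.finsum_cong') (simp_all add: P.rsmult_closed P.rsmult_assoc)
    finally show ?thesis ..
  qed
  have g_unit: "g (e i) = f (e i)" if i: "i < n" for i
  proof -
    have "g (e i) = (\<Oplus>\<^bsub>P\<^esub>k\<in>{..<n}. if i = k then f (e k) else \<zero>\<^bsub>P\<^esub>)"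
      unfolding g_def using fe by (intro P.M.finsum_cong') (auto simp: e_def unit_vector_def P.rsmult_one)
    also have "\<dots> = f (e i)"
      using i fe by (intro P.M.finsum_singleton) simp_all
    finally show ?thesis .
  qed
  have g: "g \<in> rmod_hom A (rpower A n) P"
    by (rule rmod_homI) (fact g_carrier g_add g_smult)+
  have "g v = f v" if "v \<in> carrier (rpower A\<^sub>C n)" for v
    using that
  proof (induction rule: ring.rpower_induct[OF ring_AC, consumes 1, case_names zero unit add])
    case zero
    have "g \<zero>\<^bsub>rpower A n\<^esub> = \<zero>\<^bsub>P\<^esub>"
      using g_smult[OF LA.M.zero_closed zero_closed] g_carrier[OF LA.M.zero_closed] LA.M.zero_closed
      by (simp add: restrict_def cong: if_cong)
    moreover have "f \<zero>\<^bsub>rpower A\<^sub>C n\<^esub> = \<zero>\<^bsub>P\<^esub>"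
      using rmod_homD(3)[OF f L.M.zero_closed, of \<zero>] rmod_homD(1)[OF f L.M.zero_closed]
        subringE(2)[OF C_subring]
      by (simp add: restrict_def cong: if_cong)
    moreover have "\<zero>\<^bsub>rpower A\<^sub>C n\<^esub> = \<zero>\<^bsub>rpower A n\<^esub>"
      by (simp add: rpower_def)
    ultimately show ?case by (simp only:)
  next
    case (unit i c)
    then have "g (e i \<star>\<^bsub>rpower A n\<^esub> c) = f (e i) \<star>\<^bsub>P\<^esub> c"
      using g_smult[OF rpower_AC[OF eC[of i]], of c] g_unit by simp
    moreover have "f (e i \<star>\<^bsub>rpower A\<^sub>C n\<^esub> c) = f (e i) \<star>\<^bsub>P\<^esub> c"
      using rmod_homD(3)[OF f eC[of i]] unit by simp
    moreover have "e i \<star>\<^bsub>rpower A\<^sub>C n\<^esub> c = e i \<star>\<^bsub>rpower A n\<^esub> c"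
      by (simp add: rpower_def)
    ultimately show ?case
      by (simp only: e_def unit_vector_AC)
  next
    case (add v w)
    have "v \<oplus>\<^bsub>rpower A\<^sub>C n\<^esub> w = v \<oplus>\<^bsub>rpower A n\<^esub> w"
      by (simp add: rpower_def)
    then show ?case
      using g_add[OF rpower_AC rpower_AC, OF add(1,2)] rmod_homD(2)[OF f add(1,2)] add(3,4)
      by (simp only:)
  qed
  with g show thesis using that by blast
qed

end

context subring_right_ideal
begin

abbreviation K_plus where "K_plus n \<equiv> rmod_sum (rideal_rmodule A\<^sub>C K) (rpower A\<^sub>C n)"
abbreviation KA_plus where "KA_plus n \<equiv> rmod_sum (rideal_rmodule A KA) (rpower A n)"

lemma right_module_KA_plus: "right_module A (KA_plus n)"
  by (intro right_module_sum KA.right_module_rideal right_module_rpower)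

lemma K_plus_KA_plus:
  "z \<in> carrier (K_plus n) \<Longrightarrow> z \<in> carrier (KA_plus n)"
  "z \<oplus>\<^bsub>K_plus n\<^esub> w = z \<oplus>\<^bsub>KA_plus n\<^esub> w" "z \<star>\<^bsub>K_plus n\<^esub> c = z \<star>\<^bsub>KA_plus n\<^esub> c"
  using K_KA by (auto simp: rmod_sum_def rpower_def PiE_iff split: prod.splits)

lemma rpower_AC_ops:
  "\<zero>\<^bsub>rpower A\<^sub>C n\<^esub> = \<zero>\<^bsub>rpower A n\<^esub>"
  "v \<oplus>\<^bsub>rpower A\<^sub>C n\<^esub> w = v \<oplus>\<^bsub>rpower A n\<^esub> w" "v \<star>\<^bsub>rpower A\<^sub>C n\<^esub> c = v \<star>\<^bsub>rpower A n\<^esub> c"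
  by (simp_all add: rpower_def)

lemma extend_hom_KA_plus:
  fixes j :: "'a \<Rightarrow> 'u" and P :: "('a, 'm, 'z) rmodule_scheme"
  assumes flat: "faithfully_flat TYPE('u) A\<^sub>C (ring_lmodule A)" and j: "inj j"
    and P: "right_module A P" and f: "f \<in> rmod_hom A\<^sub>C (K_plus n) P"
  obtains g where "g \<in> rmod_hom A (KA_plus n) P" "\<And>z. z \<in> carrier (K_plus n) \<Longrightarrow> g z = f z"
proof -
  interpret P: right_module A P by (rule P)
  interpret L: right_module A\<^sub>C "rpower A\<^sub>C n" by (rule ring.right_module_rpower[OF ring_AC])
  let ?o = "\<zero>\<^bsub>rpower A\<^sub>C n\<^esub>"
  have f1: "(\<lambda>k. f (k, ?o)) \<in> rmod_hom A\<^sub>C (rideal_rmodule A\<^sub>C K) P"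
  proof (rule rmod_homI)
    fix k l assume kl: "k \<in> carrier (rideal_rmodule A\<^sub>C K)" "l \<in> carrier (rideal_rmodule A\<^sub>C K)"
    show "f (k, ?o) \<in> carrier P"
      using rmod_homD(1)[OF f, of "(k, ?o)"] kl L.M.zero_closed by (simp only: rmod_sum_simps mem_Times_iff fst_conv snd_conv)
    show "f (k \<oplus>\<^bsub>rideal_rmodule A\<^sub>C K\<^esub> l, ?o) = f (k, ?o) \<oplus>\<^bsub>P\<^esub> f (l, ?o)"
      using rmod_homD(2)[OF f, of "(k, ?o)" "(l, ?o)"] kl L.M.zero_closed L.M.l_zero[OF L.M.zero_closed]
      by (simp only: rmod_sum_simps mem_Times_iff fst_conv snd_conv)
  next
    fix k c assume kc: "k \<in> carrier (rideal_rmodule A\<^sub>C K)" "c \<in> carrier A\<^sub>C"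
    show "f (k \<star>\<^bsub>rideal_rmodule A\<^sub>C K\<^esub> c, ?o) = f (k, ?o) \<star>\<^bsub>P\<^esub> c"
      using rmod_homD(3)[OF f, of "(k, ?o)" c] kc L.M.zero_closed L.zero_rsmult[OF kc(2)]
      by (simp only: rmod_sum_simps mem_Times_iff fst_conv snd_conv)
  qed
  let ?k = "\<zero>\<^bsub>rideal_rmodule A\<^sub>C K\<^esub>"
  have f2: "(\<lambda>v. f (?k, v)) \<in> rmod_hom A\<^sub>C (rpower A\<^sub>C n) P"
  proof (rule rmod_homI)
    fix v w assume vw: "v \<in> carrier (rpower A\<^sub>C n)" "w \<in> carrier (rpower A\<^sub>C n)"
    show "f (?k, v) \<in> carrier P"
      using rmod_homD(1)[OF f, of "(?k, v)"] vw KtA.M.M.zero_closed by (simp only: rmod_sum_simps mem_Times_iff fst_conv snd_conv)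
    show "f (?k, v \<oplus>\<^bsub>rpower A\<^sub>C n\<^esub> w) = f (?k, v) \<oplus>\<^bsub>P\<^esub> f (?k, w)"
      using rmod_homD(2)[OF f, of "(?k, v)" "(?k, w)"] vw KtA.M.M.zero_closed KtA.M.M.l_zero[OF KtA.M.M.zero_closed]
      by (simp only: rmod_sum_simps mem_Times_iff fst_conv snd_conv)
  next
    fix v c assume vc: "v \<in> carrier (rpower A\<^sub>C n)" "c \<in> carrier A\<^sub>C"
    show "f (?k, v \<star>\<^bsub>rpower A\<^sub>C n\<^esub> c) = f (?k, v) \<star>\<^bsub>P\<^esub> c"
      using rmod_homD(3)[OF f, of "(?k, v)" c] vc KtA.M.M.zero_closed KtA.M.zero_rsmult[OF vc(2)]
      by (simp only: rmod_sum_simps mem_Times_iff fst_conv snd_conv)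
  qed
  obtain g1 where g1: "g1 \<in> rmod_hom A (rideal_rmodule A KA) P" "\<And>k. k \<in> K \<Longrightarrow> g1 k = f (k, ?o)"
    using extend_hom_KA[OF flat j P f1] by blast
  obtain g2 where g2: "g2 \<in> rmod_hom A (rpower A n) P"
    "\<And>v. v \<in> carrier (rpower A\<^sub>C n) \<Longrightarrow> g2 v = f (?k, v)"
    using extend_hom_rpower[OF P f2] by blast
  note g1' = rmod_homD[OF g1(1)] and g2' = rmod_homD[OF g2(1)]
  define g where "g = (\<lambda>(x, v). g1 x \<oplus>\<^bsub>P\<^esub> g2 v)"
  have "g \<in> rmod_hom A (KA_plus n) P"
  proof (rule rmod_homI)
    fix z w assume "z \<in> carrier (KA_plus n)" "w \<in> carrier (KA_plus n)"
    then obtain x v y u where *: "z = (x, v)" "w = (y, u)"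
      "x \<in> carrier (rideal_rmodule A KA)" "y \<in> carrier (rideal_rmodule A KA)"
      "v \<in> carrier (rpower A n)" "u \<in> carrier (rpower A n)"
      unfolding rmod_sum_simps by blast
    then show "g z \<in> carrier P" by (simp only: g_def prod.case g1' g2' P.M.a_closed)
    show "g (z \<oplus>\<^bsub>KA_plus n\<^esub> w) = g z \<oplus>\<^bsub>P\<^esub> g w"
      using * g1'(1)[of x] g1'(1)[of y] g2'(1)[of v] g2'(1)[of u]
      by (simp only: g_def prod.case g1'(2) g2'(2) rmod_sum_simps P.M.a_ac P.M.a_closed)
  next
    fix z a assume "z \<in> carrier (KA_plus n)" and a: "a \<in> carrier A"
    then obtain x v where *: "z = (x, v)" "x \<in> carrier (rideal_rmodule A KA)" "v \<in> carrier (rpower A n)"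
      unfolding rmod_sum_simps by blast
    then show "g (z \<star>\<^bsub>KA_plus n\<^esub> a) = g z \<star>\<^bsub>P\<^esub> a"
      using a g1'(1)[of x] g2'(1)[of v]
      by (simp only: g_def prod.case g1'(3) g2'(3) rmod_sum_simps P.rsmult_l_distr)
  qed
  moreover have "g z = f z" if zc: "z \<in> carrier (K_plus n)" for z
  proof -
    obtain k v where z: "z = (k, v)" "k \<in> carrier (rideal_rmodule A\<^sub>C K)" "v \<in> carrier (rpower A\<^sub>C n)"
      using zc unfolding rmod_sum_simps by blast
    then have "f ((k, ?o) \<oplus>\<^bsub>K_plus n\<^esub> (?k, v)) = f (k, ?o) \<oplus>\<^bsub>P\<^esub> f (?k, v)"
      by (intro rmod_homD(2)[OF f]) (simp_all only: rmod_sum_simps mem_Times_iff fst_conv snd_conv L.M.zero_closed KtA.M.M.zero_closed)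
    moreover have "(k, ?o) \<oplus>\<^bsub>K_plus n\<^esub> (?k, v) = z"
      using z by (simp only: rmod_sum_simps L.M.l_zero KtA.M.M.r_zero)
    moreover have "k \<in> K" using z(2) by simp
    ultimately show ?thesis
      using z g1(2)[of k] g2(2)[of v] by (simp only: g_def prod.case)
  qed
  ultimately show thesis using that by blast
qed

text \<open>Since \<open>C\<^sup>n\<close> generates \<open>A\<^sup>n\<close>, an \<open>A\<close>-linear map is determined by its values on \<open>C\<^sup>n\<close>; the same holds
  for \<open>K \<oplus> C\<^sup>n\<close> inside \<open>KA \<oplus> A\<^sup>n\<close> below.\<close>

lemma rpower_hom_ext:
  assumes f: "f \<in> rmod_hom A (rpower A n) (rpower A n)" and id: "\<And>v. v \<in> carrier (rpower A\<^sub>C n) \<Longrightarrow> f v = v"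
    and v: "v \<in> carrier (rpower A n)"
  shows "f v = v"
proof -
  interpret L: right_module A "rpower A n" by (rule right_module_rpower)
  have e: "unit_vector A n i \<in> carrier (rpower A\<^sub>C n)" for i
    unfolding unit_vector_AC[symmetric] by (rule ring.unit_vector_carrier[OF ring_AC])
  show ?thesis
    using v
  proof (induction rule: rpower_induct)
    case zero
    show ?case by (rule rmod_hom_zero[OF f L.right_module_axioms L.right_module_axioms])
  next
    case (unit i a)
    then show ?case by (simp only: rmod_homD(3)[OF f unit_vector_carrier] id[OF e])
  next
    case (add v w)
    then show ?case by (simp only: rmod_homD(2)[OF f])
  qed
qed

lemma KA_plus_hom_ext:
  assumes f: "f \<in> rmod_hom A (KA_plus n) (KA_plus n)" and id: "\<And>z. z \<in> carrier (K_plus n) \<Longrightarrow> f z = z"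
    and z: "z \<in> carrier (KA_plus n)"
  shows "f z = z"
proof -
  interpret L: right_module A "rpower A n" by (rule right_module_rpower)
  interpret S: right_module A "KA_plus n" by (rule right_module_KA_plus)
  interpret KM: right_module A "rideal_rmodule A KA" by (rule KA.right_module_rideal)
  let ?o = "\<zero>\<^bsub>rpower A n\<^esub>"
  have o: "?o \<in> carrier (rpower A\<^sub>C n)"
    unfolding rpower_AC_ops(1)[symmetric]
    using ring.right_module_rpower[OF ring_AC, of n]
    by (simp add: right_module_def abelian_group_def abelian_monoid.zero_closed del: rpower_simps)
  obtain x v where xv: "z = (x, v)" "x \<in> KA" "v \<in> carrier (rpower A n)"
    using z unfolding rmod_sum_simps rideal_rmodule_simps by blast
  have c1: "(y, ?o) \<in> carrier (KA_plus n)" if "y \<in> KA" for y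
    using that L.M.zero_closed by (simp only: rmod_sum_simps rideal_rmodule_simps mem_Times_iff fst_conv snd_conv)
  have c2: "(\<zero>, w) \<in> carrier (KA_plus n)" if "w \<in> carrier (rpower A n)" for w
    using that KA.zero_closed by (simp only: rmod_sum_simps rideal_rmodule_simps mem_Times_iff fst_conv snd_conv)
  have 1: "f (x, ?o) = (x, ?o)"
    using xv(2)
  proof induction
    case (prod k a)
    have "(k \<otimes> a, ?o) = (k, ?o) \<star>\<^bsub>KA_plus n\<^esub> a"
      by (simp only: rmod_sum_simps L.zero_rsmult[OF prod(2)] rideal_rmodule_simps)
    moreover have "(k, ?o) \<in> carrier (K_plus n)"
      using prod o by (simp only: rmod_sum_simps rideal_rmodule_simps mem_Times_iff fst_conv snd_conv)
    ultimately show ?case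
      using rmod_homD(3)[OF f c1[OF K_KA[OF prod(1)]] prod(2)] id by (simp only:)
  next
    case (sum y y')
    have "(y \<oplus> y', ?o) = (y, ?o) \<oplus>\<^bsub>KA_plus n\<^esub> (y', ?o)"
      by (simp only: rmod_sum_simps L.M.l_zero[OF L.M.zero_closed] rideal_rmodule_simps)
    then show ?case
      using rmod_homD(2)[OF f c1[OF sum(1)] c1[OF sum(2)]] sum(3,4) by (simp only:)
  qed
  have 2: "f (\<zero>, v) = (\<zero>, v)"
    using xv(3)
  proof (induction rule: rpower_induct)
    case zero
    show ?case
      using id[of "(\<zero>, ?o)"] o K.zero_closed
      by (simp only: rmod_sum_simps rideal_rmodule_simps mem_Times_iff fst_conv snd_conv)
  next
    case (unit i a)
    have e: "unit_vector A n i \<in> carrier (rpower A\<^sub>C n)"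
      unfolding unit_vector_AC[symmetric] by (rule ring.unit_vector_carrier[OF ring_AC])
    have "(\<zero>, unit_vector A n i \<star>\<^bsub>rpower A n\<^esub> a) = (\<zero>, unit_vector A n i) \<star>\<^bsub>KA_plus n\<^esub> a"
      using KM.zero_rsmult[OF unit(2)] by (simp only: rmod_sum_simps rideal_rmodule_simps)
    moreover have "(\<zero>, unit_vector A n i) \<in> carrier (K_plus n)"
      using e K.zero_closed by (simp only: rmod_sum_simps rideal_rmodule_simps mem_Times_iff fst_conv snd_conv)
    ultimately show ?case
      using rmod_homD(3)[OF f c2[OF unit_vector_carrier] unit(2)] id by (simp only:)
  next
    case (add v w)
    have "(\<zero>, v \<oplus>\<^bsub>rpower A n\<^esub> w) = (\<zero>, v) \<oplus>\<^bsub>KA_plus n\<^esub> (\<zero>, w)"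
      by (simp only: rmod_sum_simps rideal_rmodule_simps l_zero[OF zero_closed])
    then show ?case
      using rmod_homD(2)[OF f c2[OF add(1)] c2[OF add(2)]] add(3,4) by (simp only:)
  qed
  have "z = (x, ?o) \<oplus>\<^bsub>KA_plus n\<^esub> (\<zero>, v)"
    using xv by (simp only: rmod_sum_simps rideal_rmodule_simps r_zero[OF KA_carrier] L.M.l_zero)
  then show ?thesis
    using rmod_homD(2)[OF f c1[OF xv(2)] c2[OF xv(3)]] 1 2 by (simp only:)
qed

lemma fin_gen_KA:
  assumes "rmod_fin_gen A\<^sub>C (rideal_rmodule A\<^sub>C K)"
  shows "rmod_fin_gen A (rideal_rmodule A KA)"
proof -
  interpret MA: right_module A "rideal_rmodule A KA" by (rule KA.right_module_rideal)
  obtain S where S: "finite S" "S \<subseteq> K"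
    and gen: "\<And>k. k \<in> K \<Longrightarrow> \<exists>c. (\<forall>b\<in>S. c b \<in> C) \<and> k = (\<Oplus>\<^bsub>rideal_rmodule A\<^sub>C K\<^esub>b\<in>S. b \<otimes> c b)"
    using assms unfolding KtA.M.rmod_fin_gen_iff by auto
  have SA: "b \<in> carrier A" if "b \<in> S" for b using S K_carrier that by blast
  have "\<exists>c. (\<forall>b\<in>S. c b \<in> carrier A) \<and> x = (\<Oplus>b\<in>S. b \<otimes> c b)" if "x \<in> KA" for x
    using that
  proof induction
    case (prod k a)
    obtain c where c: "\<forall>b\<in>S. c b \<in> C" "k = (\<Oplus>\<^bsub>rideal_rmodule A\<^sub>C K\<^esub>b\<in>S. b \<otimes> c b)"
      using gen[OF prod(1)] by blast
    have "k = (\<Oplus>b\<in>S. b \<otimes> c b)"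
      unfolding c(2) using S c(1) by (intro finsum_K) (auto intro: K_mult)
    then have "k \<otimes> a = (\<Oplus>b\<in>S. b \<otimes> c b \<otimes> a)"
      using S SA c(1) prod by (simp add: finsum_ldistr Pi_iff)
    also have "\<dots> = (\<Oplus>b\<in>S. b \<otimes> (c b \<otimes> a))"
      using SA c(1) prod by (intro finsum_cong') (simp_all add: m_assoc)
    finally show ?case
      using c(1) prod by (intro exI[of _ "\<lambda>b. c b \<otimes> a"]) simp
  next
    case (sum x y)
    then obtain c d where c: "\<forall>b\<in>S. c b \<in> carrier A" "x = (\<Oplus>b\<in>S. b \<otimes> c b)"
      and d: "\<forall>b\<in>S. d b \<in> carrier A" "y = (\<Oplus>b\<in>S. b \<otimes> d b)" by blast
    have "x \<oplus> y = (\<Oplus>b\<in>S. b \<otimes> c b \<oplus> b \<otimes> d b)"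
      unfolding c(2) d(2) using SA c(1) d(1) by (intro finsum_addf[symmetric]) simp_all
    also have "\<dots> = (\<Oplus>b\<in>S. b \<otimes> (c b \<oplus> d b))"
      using SA c(1) d(1) by (intro finsum_cong') (simp_all add: r_distr)
    finally show ?case
      using c(1) d(1) by (intro exI[of _ "\<lambda>b. c b \<oplus> d b"]) simp
  qed
  moreover have "(\<Oplus>\<^bsub>rideal_rmodule A KA\<^esub>b\<in>S. b \<otimes> c b) = (\<Oplus>b\<in>S. b \<otimes> c b)"
    if "\<forall>b\<in>S. c b \<in> carrier A" for c
    using that S K_KA by (intro KA.finsum_rideal) (auto intro: KA.I_r_closed)
  moreover have "S \<subseteq> KA" using S K_KA by blast
  ultimately show ?thesis
    unfolding MA.rmod_fin_gen_iff using S(1)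
    by (intro exI[of _ S]) (simp, metis)
qed

text \<open>The isomorphism \<open>K \<oplus> C\<^sup>n \<cong> C\<^sup>m\<close> and its inverse extend to \<open>A\<close>-linear maps between \<open>KA \<oplus> A\<^sup>n\<close> and \<open>A\<^sup>m\<close>.  Both
  composites of the extensions are identities on the generating submodules over \<open>C\<close>, hence everywhere.\<close>

lemma stably_free_KA:
  fixes j :: "'a \<Rightarrow> 'u"
  assumes flat: "faithfully_flat TYPE('u) A\<^sub>C (ring_lmodule A)" and j: "inj j"
    and sf: "stably_free A\<^sub>C (rideal_rmodule A\<^sub>C K)"
  shows "stably_free A (rideal_rmodule A KA)"
proof -
  obtain n m h where h: "h \<in> rmod_iso A\<^sub>C (K_plus n) (rpower A\<^sub>C m)"
    using sf by (auto simp: stably_free_def rmod_isomorphic_def)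
  have h_hom: "h \<in> rmod_hom A\<^sub>C (K_plus n) (rpower A\<^sub>C m)"
    and bij: "bij_betw h (carrier (K_plus n)) (carrier (rpower A\<^sub>C m))"
    using h by (auto simp: rmod_iso_def)
  let ?h' = "inv_into (carrier (K_plus n)) h"
  have "right_module A\<^sub>C (K_plus n)"
    by (intro right_module_sum right_module_K ring.right_module_rpower[OF ring_AC])
  then have h'_hom: "?h' \<in> rmod_hom A\<^sub>C (rpower A\<^sub>C m) (K_plus n)"
    by (rule inv_into_rmod_hom[OF h])
  have "h \<in> rmod_hom A\<^sub>C (K_plus n) (rpower A m)"
    using rmod_homD[OF h_hom] rpower_AC
    by (intro rmod_homI) (simp_all only: rpower_AC_ops)
  then obtain H where H: "H \<in> rmod_hom A (KA_plus n) (rpower A m)"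
    "\<And>z. z \<in> carrier (K_plus n) \<Longrightarrow> H z = h z"
    using extend_hom_KA_plus[OF flat j right_module_rpower] by blast
  have "?h' \<in> rmod_hom A\<^sub>C (rpower A\<^sub>C m) (KA_plus n)"
    using rmod_homD[OF h'_hom] K_plus_KA_plus
    by (intro rmod_homI) (simp_all only:)
  then obtain H' where H': "H' \<in> rmod_hom A (rpower A m) (KA_plus n)"
    "\<And>v. v \<in> carrier (rpower A\<^sub>C m) \<Longrightarrow> H' v = ?h' v"
    using extend_hom_rpower[OF right_module_KA_plus] by blast
  have 1: "H' (H z) = z" if "z \<in> carrier (KA_plus n)" for z
  proof -
    have "(H' \<circ> H) z = z"
    proof (rule KA_plus_hom_ext[OF rmod_hom_comp[OF H(1) H'(1)] _ that])
      fix w assume w: "w \<in> carrier (K_plus n)"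
      then show "(H' \<circ> H) w = w"
        using H(2)[OF w] H'(2)[OF rmod_homD(1)[OF h_hom w]] bij_betw_inv_into_left[OF bij w]
        by (simp only: o_apply)
    qed
    then show ?thesis by simp
  qed
  have 2: "H (H' v) = v" if "v \<in> carrier (rpower A m)" for v
  proof -
    have "(H \<circ> H') v = v"
    proof (rule rpower_hom_ext[OF rmod_hom_comp[OF H'(1) H(1)] _ that])
      fix w assume w: "w \<in> carrier (rpower A\<^sub>C m)"
      then show "(H \<circ> H') w = w"
        using H'(2)[OF w] H(2)[OF rmod_homD(1)[OF h'_hom w]] bij_betw_inv_into_right[OF bij w]
        by (simp only: o_apply)
    qed
    then show ?thesis by simp
  qed
  have "bij_betw H (carrier (KA_plus n)) (carrier (rpower A m))"
    using 1 2 rmod_homD(1)[OF H(1)] rmod_homD(1)[OF H'(1)] by (intro bij_betw_byWitness[where f' = H'] ballI image_subsetI)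
  then have "rmod_isomorphic A (KA_plus n) (rpower A m)"
    using H(1) by (auto simp: rmod_isomorphic_def rmod_iso_def)
  moreover have "rmod_fin_gen A (rideal_rmodule A KA)"
    using sf by (intro fin_gen_KA) (simp add: stably_free_def)
  ultimately show ?thesis
    using KA.right_module_rideal by (auto simp: stably_free_def)
qed

end


section \<open>The augmentation ideal of a graded ring\<close>

text \<open>A commutative monoid is called conical if a sum vanishes only when both summands do; by
  commutativity it suffices to ask this for one of them.\<close>

locale conical_grading = ring A + G: abelian_monoid G
  for A :: "('a, 'y) ring_scheme" (structure) and G :: "('g, 'x) ring_scheme" +
  fixes \<A> :: "'g \<Rightarrow> 'a set"
  assumes grading: "grading G A \<A>"
    and conical: "\<lbrakk>s \<in> carrier G; t \<in> carrier G; s \<oplus>\<^bsub>G\<^esub> t = \<zero>\<^bsub>G\<^esub>\<rbrakk> \<Longrightarrow> t = \<zero>\<^bsub>G\<^esub>"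
begin

abbreviation families where "families \<equiv> fin_families A (carrier G) \<A>"

abbreviation total :: "('g \<Rightarrow> 'a) \<Rightarrow> 'a" where "total f \<equiv> \<Oplus>s\<in>{s. f s \<noteq> \<zero>}. f s"

definition augmentation :: "'a set" where
  "augmentation = {total f | f. f \<in> families \<and> f \<zero>\<^bsub>G\<^esub> = \<zero>}"

lemma component: "s \<in> carrier G \<Longrightarrow> additive_subgroup (\<A> s) A"
  using grading by (simp add: grading_def)

lemma component_carrier: "s \<in> carrier G \<Longrightarrow> x \<in> \<A> s \<Longrightarrow> x \<in> carrier A"
  using additive_subgroup.a_Hcarr[OF component] .

lemma component_mult:
  "\<lbrakk>s \<in> carrier G; t \<in> carrier G; x \<in> \<A> s; y \<in> \<A> t\<rbrakk> \<Longrightarrow> x \<otimes> y \<in> \<A> (s \<oplus>\<^bsub>G\<^esub> t)"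
  using grading by (simp add: grading_def)

lemma familiesD:
  assumes "f \<in> families"
  shows "s \<in> carrier G \<Longrightarrow> f s \<in> \<A> s" "f s \<in> carrier A" "finite {s. f s \<noteq> \<zero>}"
    "{s. f s \<noteq> \<zero>} \<subseteq> carrier G"
proof -
  show 1: "s \<in> carrier G \<Longrightarrow> f s \<in> \<A> s" "finite {s. f s \<noteq> \<zero>}" "{s. f s \<noteq> \<zero>} \<subseteq> carrier G"
    using assms by (auto simp: fin_families_def)
  show "f s \<in> carrier A"
    using assms 1(1) component_carrier[of s] by (cases "s \<in> carrier G") (auto simp: fin_families_def)
qed

lemma decomposition: "a \<in> carrier A \<Longrightarrow> \<exists>!f. f \<in> families \<and> a = total f"
  using grading by (simp add: grading_def)

lemma total_eq:
  assumes "f \<in> families" "finite T" "{s. f s \<noteq> \<zero>} \<subseteq> T"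
  shows "total f = (\<Oplus>s\<in>T. f s)"
  using assms familiesD(2)[OF assms(1)] by (intro add.finprod_mono_neutral_cong_left) auto

lemma finsum_closure:
  assumes "\<And>i. i \<in> T \<Longrightarrow> f i \<in> carrier A \<and> P (f i)" "P \<zero>"
    "\<And>x y. \<lbrakk>x \<in> carrier A; y \<in> carrier A; P x; P y\<rbrakk> \<Longrightarrow> P (x \<oplus> y)"
  shows "P (finsum A f T)"
  using assms(1)
proof (induction T rule: infinite_finite_induct)
  case (insert i T)
  then have "finsum A f T \<in> carrier A" "f \<in> T \<rightarrow> carrier A"
    by (auto intro!: finsum_closed)
  then show ?case
    using insert assms(3)[of "f i" "finsum A f T"] by simp
qed (use assms(2) in simp_all)

lemma homogeneous_induct [consumes 1, case_names zero component add]: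
  assumes "a \<in> carrier A" "P \<zero>" "\<And>s x. \<lbrakk>s \<in> carrier G; x \<in> \<A> s\<rbrakk> \<Longrightarrow> P x"
    "\<And>x y. \<lbrakk>x \<in> carrier A; y \<in> carrier A; P x; P y\<rbrakk> \<Longrightarrow> P (x \<oplus> y)"
  shows "P a"
proof -
  obtain f where f: "f \<in> families" "a = total f"
    using decomposition[OF assms(1)] by blast
  have "f s \<in> carrier A \<and> P (f s)" if "f s \<noteq> \<zero>" for s
    using that assms(3)[of s "f s"] familiesD[OF f(1)] by blast
  then show ?thesis
    unfolding f(2) by (rule finsum_closure[where P = P]) (simp_all add: assms(2,4))
qed

lemma augmentation_carrier: "j \<in> augmentation \<Longrightarrow> j \<in> carrier A"
  using familiesD(2) by (auto simp: augmentation_def intro!: finsum_closed)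

lemma augmentation_induct [consumes 1, case_names zero component add]:
  assumes "j \<in> augmentation" "P \<zero>"
    "\<And>s x. \<lbrakk>s \<in> carrier G; s \<noteq> \<zero>\<^bsub>G\<^esub>; x \<in> \<A> s\<rbrakk> \<Longrightarrow> P x"
    "\<And>x y. \<lbrakk>x \<in> carrier A; y \<in> carrier A; P x; P y\<rbrakk> \<Longrightarrow> P (x \<oplus> y)"
  shows "P j"
proof -
  obtain f where f: "f \<in> families" "j = total f" "f \<zero>\<^bsub>G\<^esub> = \<zero>"
    using assms(1) by (auto simp: augmentation_def)
  have "f s \<in> carrier A \<and> P (f s)" if "f s \<noteq> \<zero>" for s
    using that f(3) assms(3)[of s "f s"] familiesD[OF f(1)] by blast
  then show ?thesis
    unfolding f(2) by (rule finsum_closure[where P = P]) (simp_all add: assms(2,4))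
qed

lemma zero_augmentation: "\<zero> \<in> augmentation"
proof -
  have "(\<lambda>_. \<zero>) \<in> families"
    using additive_subgroup.zero_closed[OF component] by (simp add: fin_families_def)
  then show ?thesis
    unfolding augmentation_def by (intro CollectI exI[of _ "\<lambda>_. \<zero>"]) simp
qed

lemma augmentation_add:
  assumes "i \<in> augmentation" "j \<in> augmentation" shows "i \<oplus> j \<in> augmentation"
proof -
  obtain f where f: "f \<in> families" "i = total f" "f \<zero>\<^bsub>G\<^esub> = \<zero>"
    using assms(1) by (auto simp: augmentation_def)
  obtain g where g: "g \<in> families" "j = total g" "g \<zero>\<^bsub>G\<^esub> = \<zero>"
    using assms(2) by (auto simp: augmentation_def)
  let ?h = "\<lambda>s. f s \<oplus> g s" and ?T = "{s. f s \<noteq> \<zero>} \<union> {s. g s \<noteq> \<zero>}"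
  have T: "finite ?T" using familiesD(3) f g by blast
  have sub: "{s. ?h s \<noteq> \<zero>} \<subseteq> ?T" by auto
  have h: "?h \<in> families"
    using f(1) g(1) finite_subset[OF sub T] additive_subgroup.a_closed[OF component]
    by (simp add: fin_families_def)
  have "i \<oplus> j = (\<Oplus>s\<in>?T. f s) \<oplus> (\<Oplus>s\<in>?T. g s)"
    unfolding f(2) g(2) using total_eq[OF f(1) T] total_eq[OF g(1) T] by simp
  also have "\<dots> = (\<Oplus>s\<in>?T. ?h s)"
    using familiesD(2) f g by (intro finsum_addf[symmetric]) auto
  also have "\<dots> = total ?h"
    using total_eq[OF h T sub] ..
  finally show ?thesis
    unfolding augmentation_def using h f(3) g(3) by (intro CollectI exI[of _ ?h]) simp
qed

lemma single_family:
  assumes "s \<in> carrier G" "x \<in> \<A> s"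
  shows "(\<lambda>t. if t = s then x else \<zero>) \<in> families" "total (\<lambda>t. if t = s then x else \<zero>) = x"
proof -
  let ?f = "\<lambda>t. if t = s then x else \<zero>"
  have sub: "{t. ?f t \<noteq> \<zero>} \<subseteq> {s}" by auto
  show f: "?f \<in> families"
    using assms finite_subset[OF sub] additive_subgroup.zero_closed[OF component]
    by (auto simp: fin_families_def)
  show "total ?f = x"
    using total_eq[OF f _ sub] component_carrier[OF assms] by simp
qed

lemma component_augmentation:
  "\<lbrakk>s \<in> carrier G; s \<noteq> \<zero>\<^bsub>G\<^esub>; x \<in> \<A> s\<rbrakk> \<Longrightarrow> x \<in> augmentation"
  using single_family[of s x] unfolding augmentation_def
  by (intro CollectI exI[of _ "\<lambda>t. if t = s then x else \<zero>"]) auto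

lemma augmentation_mult:
  assumes "a \<in> carrier A" "j \<in> augmentation"
  shows "a \<otimes> j \<in> augmentation" "j \<otimes> a \<in> augmentation"
proof -
  have mult: "x \<otimes> y \<in> augmentation \<and> y \<otimes> x \<in> augmentation"
    if "s \<in> carrier G" "x \<in> \<A> s" "t \<in> carrier G" "t \<noteq> \<zero>\<^bsub>G\<^esub>" "y \<in> \<A> t" for s t x y
  proof -
    have "s \<oplus>\<^bsub>G\<^esub> t \<noteq> \<zero>\<^bsub>G\<^esub>" using conical that by blast
    then show ?thesis
      using component_mult[of s t x y] component_mult[of t s y x] that
        component_augmentation[of "s \<oplus>\<^bsub>G\<^esub> t"] by (simp add: G.a_comm)
  qed
  have "a \<otimes> j \<in> augmentation \<and> j \<otimes> a \<in> augmentation"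
    using assms(2)
  proof (induction rule: augmentation_induct)
    case zero
    then show ?case using assms zero_augmentation by simp
  next
    case (add x y)
    then show ?case using assms by (simp add: l_distr r_distr augmentation_add)
  next
    case (component t y)
    then have y: "y \<in> carrier A" using component_carrier by blast
    show ?case
      using assms(1)
    proof (induction rule: homogeneous_induct)
      case zero
      then show ?case using y zero_augmentation by simp
    next
      case (add x x')
      then show ?case using y by (simp add: l_distr r_distr augmentation_add)
    next
      case (component s x)
      then show ?case using mult \<open>t \<in> carrier G\<close> \<open>t \<noteq> \<zero>\<^bsub>G\<^esub>\<close> \<open>y \<in> \<A> t\<close> by blast
    qed
  qed
  then show "a \<otimes> j \<in> augmentation" "j \<otimes> a \<in> augmentation" by auto
qed

text \<open>Multiplying by an element of degree \<open>s\<close> moves degree \<open>t\<close> to degree \<open>s + t\<close>, which is nonzero whenever \<open>t\<close> is;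
  so in a product, components of nonzero degree never contribute to degree zero.\<close>

lemma ideal_augmentation: "ideal augmentation A"
proof (rule idealI)
  show "subgroup augmentation (add_monoid A)"
  proof (rule add.subgroupI)
    show "\<ominus> j \<in> augmentation" if "j \<in> augmentation" for j
      using augmentation_mult(1)[of "\<ominus> \<one>" j] that augmentation_carrier by (simp add: l_minus)
  qed (use zero_augmentation in \<open>auto simp: augmentation_carrier augmentation_add\<close>)
qed (auto simp: augmentation_mult ring_axioms)

lemma augmentation_split:
  assumes "a \<in> carrier A" shows "\<exists>c\<in>\<A> \<zero>\<^bsub>G\<^esub>. a \<ominus> c \<in> augmentation"
proof -
  obtain f where f: "f \<in> families" "a = total f"
    using decomposition[OF assms] by blast
  let ?T = "{s. f s \<noteq> \<zero>}" and ?j = "\<Oplus>s\<in>{s. f s \<noteq> \<zero>} - {\<zero>\<^bsub>G\<^esub>}. f s"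
  have "?j \<in> augmentation"
  proof (rule finsum_closure[where P = "\<lambda>x. x \<in> augmentation"])
    fix s assume "s \<in> ?T - {\<zero>\<^bsub>G\<^esub>}"
    then show "f s \<in> carrier A \<and> f s \<in> augmentation"
      using familiesD[OF f(1)] component_augmentation by blast
  qed (simp_all add: zero_augmentation augmentation_add)
  moreover have "a = f \<zero>\<^bsub>G\<^esub> \<oplus> ?j"
  proof -
    have "a = (\<Oplus>s\<in>insert \<zero>\<^bsub>G\<^esub> (?T - {\<zero>\<^bsub>G\<^esub>}). f s)"
      unfolding f(2) using familiesD(3)[OF f(1)] by (intro total_eq[OF f(1)]) auto
    also have "\<dots> = f \<zero>\<^bsub>G\<^esub> \<oplus> ?j"
      using familiesD(2,3)[OF f(1)] by (intro finsum_insert) auto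
    finally show ?thesis .
  qed
  moreover have "?j \<in> carrier A"
    using familiesD(2)[OF f(1)] by (auto intro!: finsum_closed)
  ultimately have "a \<ominus> f \<zero>\<^bsub>G\<^esub> \<in> augmentation"
    using familiesD(2)[OF f(1)] by (simp add: a_minus_def a_ac r_neg1 r_neg2)
  then show ?thesis
    using familiesD(1)[OF f(1) G.zero_closed] by blast
qed

lemma augmentation_degree_zero: "\<A> \<zero>\<^bsub>G\<^esub> \<inter> augmentation = {\<zero>}"
proof -
  have "c = \<zero>" if c: "c \<in> \<A> \<zero>\<^bsub>G\<^esub>" "c \<in> augmentation" for c
  proof -
    obtain f where f: "f \<in> families" "c = total f" "f \<zero>\<^bsub>G\<^esub> = \<zero>"
      using c(2) by (auto simp: augmentation_def)
    let ?g = "\<lambda>t. if t = \<zero>\<^bsub>G\<^esub> then c else \<zero>"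
    have "?g \<in> families \<and> c = total ?g"
      using single_family[OF G.zero_closed c(1)] by simp
    then have "f = ?g"
      using f(1,2) decomposition[OF augmentation_carrier[OF c(2)]] by (simp only: Ex1_def) blast
    from fun_cong[OF this, of "\<zero>\<^bsub>G\<^esub>"] show ?thesis using f(3) by simp
  qed
  then show ?thesis
    using zero_augmentation additive_subgroup.zero_closed[OF component] by blast
qed

end


section \<open>Lifting stably free non-free right ideals\<close>

theorem theorem5p3:
  fixes G :: "('g, 'x) ring_scheme"
    and A A\<^sub>0 :: "('a, 'y) ring_scheme"
    and \<A> :: "'g \<Rightarrow> 'a set"
    and K :: "'a set"
  assumes "ordered_like G"
    and "noncomm_domain A"
    and "grading G A \<A>"
    and "A\<^sub>0 = degree_zero_ring G A \<A>"
    and "invariant_basis_number A"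
    and "invariant_basis_number A\<^sub>0"
    and "faithfully_flat TYPE((nat \<Rightarrow> 'a) set) A\<^sub>0 (ring_lmodule A)"
    and "right_ideal K A\<^sub>0"
    and "stably_free A\<^sub>0 (rideal_rmodule A\<^sub>0 K)"
    and "\<not> rmod_free A\<^sub>0 (rideal_rmodule A\<^sub>0 K)"
  shows "right_ideal (K \<cdot>\<^bsub>A\<^esub> carrier A) A
    \<and> (\<exists>h \<in> rmod_iso A
          (tensor_rmodule A\<^sub>0 (rideal_rmodule A\<^sub>0 K) (ring_lmodule A) (rideal_rmodule A (carrier A)))
          (rideal_rmodule A (K \<cdot>\<^bsub>A\<^esub> carrier A)).
        \<forall>k\<in>K. \<forall>a\<in>carrier A.
          h (pure_tensor A\<^sub>0 (rideal_rmodule A\<^sub>0 K) (ring_lmodule A) k a) = k \<otimes>\<^bsub>A\<^esub> a)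
    \<and> stably_free A (rideal_rmodule A (K \<cdot>\<^bsub>A\<^esub> carrier A))
    \<and> \<not> rmod_free A (rideal_rmodule A (K \<cdot>\<^bsub>A\<^esub> carrier A))"
proof -
  interpret dom: noncomm_domain A by fact
  interpret G: abelian_monoid G
    using \<open>ordered_like G\<close> by (simp add: ordered_like_def)
  \<comment> \<open>If two elements add up to zero, each is invertible, hence zero.\<close>
  have G_conical: "\<tau> = \<zero>\<^bsub>G\<^esub>" if "\<rho> \<in> carrier G" "\<tau> \<in> carrier G" "\<rho> \<oplus>\<^bsub>G\<^esub> \<tau> = \<zero>\<^bsub>G\<^esub>" for \<rho> \<tau>
  proof -
    have "\<tau> \<in> Units (add_monoid G)"
      using that by (auto simp: Units_def G.a_comm)
    then show ?thesis
      using \<open>ordered_like G\<close> by (simp add: ordered_like_def)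
  qed
  interpret conical_grading A G \<A>
    by unfold_locales (fact assms(3), fact G_conical)
  have A0: "A\<^sub>0 = A\<lparr>carrier := \<A> \<zero>\<^bsub>G\<^esub>\<rparr>"
    using assms(4) by (simp add: degree_zero_ring_def)
  have "ring A\<^sub>0"
    using assms(8) by (rule right_ideal.axioms)
  then have subring: "subring (\<A> \<zero>\<^bsub>G\<^esub>) A"
    using component_carrier[OF G.zero_closed] unfolding A0 by (intro dom.ring_incl_imp_subring) auto
  interpret S: subring_right_ideal A "\<A> \<zero>\<^bsub>G\<^esub>" K
    using assms(8) unfolding A0
    by (intro subring_right_ideal.intro subring_right_ideal_axioms.intro dom.ring_axioms subring)
  \<comment> \<open>An embedding into the type of the test modules: each element becomes the singleton of a constant sequence.\<close>
  define j :: "'a \<Rightarrow> (nat \<Rightarrow> 'a) set" where "j = (\<lambda>a. {\<lambda>_. a})"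
  have j: "inj j"
    by (auto simp: j_def inj_def fun_eq_iff)
  note flat = assms(7)[unfolded A0]
  obtain h where h: "h \<in> rmod_iso A S.K_tensor_A (rideal_rmodule A S.KA)"
    "\<And>k a. \<lbrakk>k \<in> K; a \<in> carrier A\<rbrakk> \<Longrightarrow> h (S.KtA.pure k a) = k \<otimes>\<^bsub>A\<^esub> a"
    using S.K_tensor_A_iso_KA[OF flat j] by blast
  have "\<not> rmod_free A (rideal_rmodule A S.KA)"
  proof
    assume "rmod_free A (rideal_rmodule A S.KA)"
    then obtain B where "rmod_basis A (rideal_rmodule A S.KA) B"
      by (auto simp: rmod_free_def)
    then have "\<exists>B'. rmod_basis S.A\<^sub>C (rideal_rmodule S.A\<^sub>C K) B'"
      using ideal_augmentation augmentation_split augmentation_degree_zero dom.one_not_zero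
      by (intro S.free_descends[of augmentation B])
    then have "rmod_free A\<^sub>0 (rideal_rmodule A\<^sub>0 K)"
      using S.right_module_K by (simp add: rmod_free_def A0)
    with assms(10) show False by contradiction
  qed
  moreover have "stably_free A (rideal_rmodule A S.KA)"
    using S.stably_free_KA[OF flat j] assms(9) by (simp add: A0)
  moreover have "right_ideal S.KA A" by (rule S.KA_right_ideal)
  ultimately show ?thesis
    using h unfolding A0 by blast
qed

end
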